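(* Let $D$ be a dcpo with an apartness relation $\#$ (an irreflexive and symmetric binary relation). (i) If $D$ has elements $x,y$ with $x$ strictly below $y$, then tightness of $\#$ implies excluded middle. (ii) If $D$ has elements $x\sqsubseteq y$ with $x\# y$, then cotransitivity of $\#$ implies weak excluded middle.
   Context: We work constructively: informal set theory without excluded middle or choice. A dcpo is a poset in which every directed subset (inhabited, and any two elements have an upper bound in it) has a supremum $\bigsqcup S$. An element $x$ of a dcpo is strictly below $y$ if $x\sqsubseteq y$ and for every $z\sqsupseteq y$ and every proposition $P$, the equality $z=\bigsqcup(\{x\}\cup\{z\mid P\})$ implies $P$ (here $\{z\mid P\}$ is the subset containing $z$ exactly when $P$ holds). An apartness $\#$ on a set $X$ is tight if $\neg(x\# y)$ implies $x=y$, and cotransitive if $x\# y$ implies ($x\# z$ or $y\# z$) for all $x,y,z\in X$. Excluded middle: $P\vee\neg P$ for every proposition $P$. Weak excluded middle: $\neg P\vee\neg\neg P$ for every proposition $P$. *)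

theory Defs
  imports Main
begin

text \<open>
  The logic of Isabelle/HOL is classical, so the claim that a hypothesis implies excluded middle is
  only meaningful about derivability in a constructive system. The system used here is
  intuitionistic Zermelo-Fraenkel set theory IZF: first-order intuitionistic logic with equality
  over the single relation symbol of membership, without excluded middle and without choice.
\<close>

section \<open>Intuitionistic first-order logic in the language of set theory\<close>

text \<open>
  Variables are de Bruijn indices; the language has no terms other than variables. Indices that
  exceed the number of enclosing quantifiers are free variables (parameters).
\<close>

datatype fm =
    Mem nat nat
  | Eql nat nat
  | Bot
  | Conj fm fm
  | Disj fm fm
  | Imp fm fm
  | All fm
  | Ex fm

primrec rename :: "(nat \<Rightarrow> nat) \<Rightarrow> fm \<Rightarrow> fm" where
  "rename f (Mem i j) = Mem (f i) (f j)"
| "rename f (Eql i j) = Eql (f i) (f j)"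
| "rename f Bot = Bot"
| "rename f (Conj A B) = Conj (rename f A) (rename f B)"
| "rename f (Disj A B) = Disj (rename f A) (rename f B)"
| "rename f (Imp A B) = Imp (rename f A) (rename f B)"
| "rename f (All A) = All (rename (case_nat 0 (\<lambda>k. Suc (f k))) A)"
| "rename f (Ex A) = Ex (rename (case_nat 0 (\<lambda>k. Suc (f k))) A)"

text \<open>\<open>subst0 t A\<close> puts the variable \<open>t\<close> for index 0 and lowers the other indices by one.\<close>

definition subst0 :: "nat \<Rightarrow> fm \<Rightarrow> fm" where
  "subst0 t = rename (case_nat t (\<lambda>k. k))"

section \<open>Writing formulas with named variables\<close>

text \<open>
  A \<open>form\<close> is a formula as a function of its quantifier depth \<open>n\<close>, that is, the number of
  quantifiers around it. In a \<open>form\<close> a bound variable is represented by its level: the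
  quantifier at depth \<open>n\<close> binds the variable with level \<open>n\<close>, whose index at depth \<open>m > n\<close> is
  \<open>m - Suc n\<close>. So HOL binders name the variables, and a closed formula is obtained by application
  to depth 0.
\<close>

type_synonym form = "nat \<Rightarrow> fm"

definition mem_f :: "nat \<Rightarrow> nat \<Rightarrow> form" (infix "\<^bold>\<in>" 50) where
  "(x \<^bold>\<in> y) = (\<lambda>n. Mem (n - Suc x) (n - Suc y))"

definition eq_f :: "nat \<Rightarrow> nat \<Rightarrow> form" (infix "\<^bold>=" 50) where
  "(x \<^bold>= y) = (\<lambda>n. Eql (n - Suc x) (n - Suc y))"

definition conj_f :: "form \<Rightarrow> form \<Rightarrow> form" (infixr "\<^bold>\<and>" 35) where
  "(A \<^bold>\<and> B) = (\<lambda>n. Conj (A n) (B n))"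

definition disj_f :: "form \<Rightarrow> form \<Rightarrow> form" (infixr "\<^bold>\<or>" 30) where
  "(A \<^bold>\<or> B) = (\<lambda>n. Disj (A n) (B n))"

definition imp_f :: "form \<Rightarrow> form \<Rightarrow> form" (infixr "\<^bold>\<longrightarrow>" 25) where
  "(A \<^bold>\<longrightarrow> B) = (\<lambda>n. Imp (A n) (B n))"

definition iff_f :: "form \<Rightarrow> form \<Rightarrow> form" (infixr "\<^bold>\<longleftrightarrow>" 25) where
  "(A \<^bold>\<longleftrightarrow> B) = ((A \<^bold>\<longrightarrow> B) \<^bold>\<and> (B \<^bold>\<longrightarrow> A))"

definition not_f :: "form \<Rightarrow> form" ("\<^bold>\<not> _" [40] 40) where
  "(\<^bold>\<not> A) = (A \<^bold>\<longrightarrow> (\<lambda>n. Bot))"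

definition all_f :: "(nat \<Rightarrow> form) \<Rightarrow> form" (binder "\<^bold>\<forall>" 10) where
  "all_f F = (\<lambda>n. All (F n (Suc n)))"

definition ex_f :: "(nat \<Rightarrow> form) \<Rightarrow> form" (binder "\<^bold>\<exists>" 10) where
  "ex_f F = (\<lambda>n. Ex (F n (Suc n)))"

text \<open>
  For axiom schemes: an arbitrary formula \<open>A\<close> whose first \<open>length xs\<close> indices are replaced by the
  variables (levels) \<open>xs\<close>; the further indices are the parameters of the scheme.
\<close>

definition scheme :: "fm \<Rightarrow> nat list \<Rightarrow> form" where
  "scheme A xs = (\<lambda>n. rename
     (\<lambda>k. if k < length xs then n - Suc (xs ! k) else k - length xs + n) A)"

section \<open>IZF\<close>

definition empty_f :: "nat \<Rightarrow> form" where
  "empty_f e = (\<^bold>\<forall>w. \<^bold>\<not> w \<^bold>\<in> e)"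

inductive_set IZF :: "fm set" where
  extensionality:
    "(\<^bold>\<forall>a. \<^bold>\<forall>b. (\<^bold>\<forall>w. w \<^bold>\<in> a \<^bold>\<longleftrightarrow> w \<^bold>\<in> b) \<^bold>\<longrightarrow> a \<^bold>= b) 0 \<in> IZF"
| pairing:
    "(\<^bold>\<forall>a. \<^bold>\<forall>b. \<^bold>\<exists>c. \<^bold>\<forall>w. w \<^bold>\<in> c \<^bold>\<longleftrightarrow> (w \<^bold>= a \<^bold>\<or> w \<^bold>= b)) 0 \<in> IZF"
| union:
    "(\<^bold>\<forall>a. \<^bold>\<exists>u. \<^bold>\<forall>w. w \<^bold>\<in> u \<^bold>\<longleftrightarrow> (\<^bold>\<exists>b. b \<^bold>\<in> a \<^bold>\<and> w \<^bold>\<in> b)) 0 \<in> IZF"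
| powerset:
    "(\<^bold>\<forall>a. \<^bold>\<exists>p. \<^bold>\<forall>s. s \<^bold>\<in> p \<^bold>\<longleftrightarrow> (\<^bold>\<forall>w. w \<^bold>\<in> s \<^bold>\<longrightarrow> w \<^bold>\<in> a)) 0 \<in> IZF"
| infinity:
    "(\<^bold>\<exists>a. (\<^bold>\<exists>e. e \<^bold>\<in> a \<^bold>\<and> empty_f e) \<^bold>\<and>
        (\<^bold>\<forall>x. x \<^bold>\<in> a \<^bold>\<longrightarrow> (\<^bold>\<exists>y. y \<^bold>\<in> a \<^bold>\<and> (\<^bold>\<forall>w. w \<^bold>\<in> y \<^bold>\<longleftrightarrow> (w \<^bold>\<in> x \<^bold>\<or> w \<^bold>= x))))) 0 \<in> IZF"
| separation:
    "(\<^bold>\<forall>a. \<^bold>\<exists>b. \<^bold>\<forall>x. x \<^bold>\<in> b \<^bold>\<longleftrightarrow> (x \<^bold>\<in> a \<^bold>\<and> scheme A [x])) 0 \<in> IZF"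
| collection:
    "(\<^bold>\<forall>a. (\<^bold>\<forall>x. x \<^bold>\<in> a \<^bold>\<longrightarrow> (\<^bold>\<exists>y. scheme A [x, y])) \<^bold>\<longrightarrow>
        (\<^bold>\<exists>b. \<^bold>\<forall>x. x \<^bold>\<in> a \<^bold>\<longrightarrow> (\<^bold>\<exists>y. y \<^bold>\<in> b \<^bold>\<and> scheme A [x, y]))) 0 \<in> IZF"
| set_induction:
    "((\<^bold>\<forall>x. (\<^bold>\<forall>y. y \<^bold>\<in> x \<^bold>\<longrightarrow> scheme A [y]) \<^bold>\<longrightarrow> scheme A [x]) \<^bold>\<longrightarrow> (\<^bold>\<forall>x. scheme A [x])) 0 \<in> IZF"

inductive deriv :: "fm set \<Rightarrow> fm \<Rightarrow> bool" (infix "\<turnstile>" 55) where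
  Assm: "A \<in> G \<Longrightarrow> G \<turnstile> A"
| Axiom: "A \<in> IZF \<Longrightarrow> G \<turnstile> A"
| BotE: "G \<turnstile> Bot \<Longrightarrow> G \<turnstile> A"
| ConjI: "G \<turnstile> A \<Longrightarrow> G \<turnstile> B \<Longrightarrow> G \<turnstile> Conj A B"
| ConjE1: "G \<turnstile> Conj A B \<Longrightarrow> G \<turnstile> A"
| ConjE2: "G \<turnstile> Conj A B \<Longrightarrow> G \<turnstile> B"
| DisjI1: "G \<turnstile> A \<Longrightarrow> G \<turnstile> Disj A B"
| DisjI2: "G \<turnstile> B \<Longrightarrow> G \<turnstile> Disj A B"
| DisjE: "G \<turnstile> Disj A B \<Longrightarrow> insert A G \<turnstile> C \<Longrightarrow> insert B G \<turnstile> C \<Longrightarrow> G \<turnstile> C"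
| ImpI: "insert A G \<turnstile> B \<Longrightarrow> G \<turnstile> Imp A B"
| ImpE: "G \<turnstile> Imp A B \<Longrightarrow> G \<turnstile> A \<Longrightarrow> G \<turnstile> B"
| AllI: "rename Suc ` G \<turnstile> A \<Longrightarrow> G \<turnstile> All A"
| AllE: "G \<turnstile> All A \<Longrightarrow> G \<turnstile> subst0 t A"
| ExI: "G \<turnstile> subst0 t A \<Longrightarrow> G \<turnstile> Ex A"
| ExE: "G \<turnstile> Ex A \<Longrightarrow> insert A (rename Suc ` G) \<turnstile> rename Suc C \<Longrightarrow> G \<turnstile> C"
| EqlI: "G \<turnstile> Eql t t"
| EqlE: "G \<turnstile> Eql s t \<Longrightarrow> G \<turnstile> subst0 s A \<Longrightarrow> G \<turnstile> subst0 t A"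

definition IZF_proves :: "form \<Rightarrow> bool" where
  "IZF_proves A \<longleftrightarrow> {} \<turnstile> A 0"

section \<open>Propositions\<close>

text \<open>
  As usual in IZF, a proposition is a subset \<open>p\<close> of the singleton of the empty set, and it holds
  when the empty set is an element of \<open>p\<close>. By separation, every formula is equivalent to the
  truth of such a \<open>p\<close>.
\<close>

definition is_prop :: "nat \<Rightarrow> form" where
  "is_prop p = (\<^bold>\<forall>w. w \<^bold>\<in> p \<^bold>\<longrightarrow> empty_f w)"

definition holds :: "nat \<Rightarrow> form" where
  "holds p = (\<^bold>\<exists>e. empty_f e \<^bold>\<and> e \<^bold>\<in> p)"

definition excluded_middle :: form where
  "excluded_middle = (\<^bold>\<forall>p. is_prop p \<^bold>\<longrightarrow> holds p \<^bold>\<or> \<^bold>\<not> holds p)"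

definition weak_excluded_middle :: form where
  "weak_excluded_middle = (\<^bold>\<forall>p. is_prop p \<^bold>\<longrightarrow> \<^bold>\<not> holds p \<^bold>\<or> \<^bold>\<not> \<^bold>\<not> holds p)"

section \<open>Binary relations\<close>

text \<open>\<open>is_pair q x y\<close>: the set \<open>q\<close> is the Kuratowski pair of \<open>x\<close> and \<open>y\<close>.\<close>

definition is_upair :: "nat \<Rightarrow> nat \<Rightarrow> nat \<Rightarrow> form" where
  "is_upair u x y = (\<^bold>\<forall>w. w \<^bold>\<in> u \<^bold>\<longleftrightarrow> (w \<^bold>= x \<^bold>\<or> w \<^bold>= y))"

definition is_pair :: "nat \<Rightarrow> nat \<Rightarrow> nat \<Rightarrow> form" where
  "is_pair q x y = (\<^bold>\<forall>u. u \<^bold>\<in> q \<^bold>\<longleftrightarrow> (is_upair u x x \<^bold>\<or> is_upair u x y))"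

definition rel :: "nat \<Rightarrow> nat \<Rightarrow> nat \<Rightarrow> form" where
  "rel r x y = (\<^bold>\<exists>q. is_pair q x y \<^bold>\<and> q \<^bold>\<in> r)"

definition relation_on :: "nat \<Rightarrow> nat \<Rightarrow> form" where
  "relation_on D r = (\<^bold>\<forall>q. q \<^bold>\<in> r \<^bold>\<longrightarrow> (\<^bold>\<exists>x. x \<^bold>\<in> D \<^bold>\<and> (\<^bold>\<exists>y. y \<^bold>\<in> D \<^bold>\<and> is_pair q x y)))"

section \<open>Dcpos\<close>

definition poset :: "nat \<Rightarrow> nat \<Rightarrow> form" where
  "poset D le = (relation_on D le \<^bold>\<and>
     (\<^bold>\<forall>x. x \<^bold>\<in> D \<^bold>\<longrightarrow> rel le x x) \<^bold>\<and>
     (\<^bold>\<forall>x. x \<^bold>\<in> D \<^bold>\<longrightarrow> (\<^bold>\<forall>y. y \<^bold>\<in> D \<^bold>\<longrightarrow> (\<^bold>\<forall>z. z \<^bold>\<in> D \<^bold>\<longrightarrow>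
        rel le x y \<^bold>\<longrightarrow> rel le y z \<^bold>\<longrightarrow> rel le x z))) \<^bold>\<and>
     (\<^bold>\<forall>x. x \<^bold>\<in> D \<^bold>\<longrightarrow> (\<^bold>\<forall>y. y \<^bold>\<in> D \<^bold>\<longrightarrow> rel le x y \<^bold>\<longrightarrow> rel le y x \<^bold>\<longrightarrow> x \<^bold>= y)))"

definition subset_f :: "nat \<Rightarrow> nat \<Rightarrow> form" where
  "subset_f S D = (\<^bold>\<forall>w. w \<^bold>\<in> S \<^bold>\<longrightarrow> w \<^bold>\<in> D)"

definition directed :: "nat \<Rightarrow> nat \<Rightarrow> form" where
  "directed le S = ((\<^bold>\<exists>a. a \<^bold>\<in> S) \<^bold>\<and>
     (\<^bold>\<forall>a. a \<^bold>\<in> S \<^bold>\<longrightarrow> (\<^bold>\<forall>b. b \<^bold>\<in> S \<^bold>\<longrightarrow> (\<^bold>\<exists>c. c \<^bold>\<in> S \<^bold>\<and> rel le a c \<^bold>\<and> rel le b c))))"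

definition is_sup :: "nat \<Rightarrow> nat \<Rightarrow> nat \<Rightarrow> nat \<Rightarrow> form" where
  "is_sup D le S s = (s \<^bold>\<in> D \<^bold>\<and> (\<^bold>\<forall>a. a \<^bold>\<in> S \<^bold>\<longrightarrow> rel le a s) \<^bold>\<and>
     (\<^bold>\<forall>u. u \<^bold>\<in> D \<^bold>\<longrightarrow> (\<^bold>\<forall>a. a \<^bold>\<in> S \<^bold>\<longrightarrow> rel le a u) \<^bold>\<longrightarrow> rel le s u))"

definition dcpo :: "nat \<Rightarrow> nat \<Rightarrow> form" where
  "dcpo D le = (poset D le \<^bold>\<and>
     (\<^bold>\<forall>S. subset_f S D \<^bold>\<longrightarrow> directed le S \<^bold>\<longrightarrow> (\<^bold>\<exists>s. is_sup D le S s)))"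

text \<open>\<open>is_cond_set S x z p\<close>: \<open>S\<close> is the union of the singleton of \<open>x\<close> and the set
  that contains exactly \<open>z\<close> on condition that \<open>p\<close> holds.\<close>

definition is_cond_set :: "nat \<Rightarrow> nat \<Rightarrow> nat \<Rightarrow> nat \<Rightarrow> form" where
  "is_cond_set S x z p = (\<^bold>\<forall>w. w \<^bold>\<in> S \<^bold>\<longleftrightarrow> (w \<^bold>= x \<^bold>\<or> (w \<^bold>= z \<^bold>\<and> holds p)))"

definition strictly_below :: "nat \<Rightarrow> nat \<Rightarrow> nat \<Rightarrow> nat \<Rightarrow> form" where
  "strictly_below D le x y = (rel le x y \<^bold>\<and>
     (\<^bold>\<forall>z. z \<^bold>\<in> D \<^bold>\<longrightarrow> rel le y z \<^bold>\<longrightarrow> (\<^bold>\<forall>p. is_prop p \<^bold>\<longrightarrow>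
        (\<^bold>\<exists>S. is_cond_set S x z p \<^bold>\<and> is_sup D le S z) \<^bold>\<longrightarrow> holds p)))"

section \<open>Apartness\<close>

definition apartness :: "nat \<Rightarrow> nat \<Rightarrow> form" where
  "apartness D ap = (relation_on D ap \<^bold>\<and>
     (\<^bold>\<forall>x. x \<^bold>\<in> D \<^bold>\<longrightarrow> \<^bold>\<not> rel ap x x) \<^bold>\<and>
     (\<^bold>\<forall>x. x \<^bold>\<in> D \<^bold>\<longrightarrow> (\<^bold>\<forall>y. y \<^bold>\<in> D \<^bold>\<longrightarrow> rel ap x y \<^bold>\<longrightarrow> rel ap y x)))"

definition tight :: "nat \<Rightarrow> nat \<Rightarrow> form" where
  "tight D ap = (\<^bold>\<forall>x. x \<^bold>\<in> D \<^bold>\<longrightarrow> (\<^bold>\<forall>y. y \<^bold>\<in> D \<^bold>\<longrightarrow> \<^bold>\<not> rel ap x y \<^bold>\<longrightarrow> x \<^bold>= y))"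

definition cotransitive :: "nat \<Rightarrow> nat \<Rightarrow> form" where
  "cotransitive D ap = (\<^bold>\<forall>x. x \<^bold>\<in> D \<^bold>\<longrightarrow> (\<^bold>\<forall>y. y \<^bold>\<in> D \<^bold>\<longrightarrow> (\<^bold>\<forall>z. z \<^bold>\<in> D \<^bold>\<longrightarrow>
     rel ap x y \<^bold>\<longrightarrow> rel ap x z \<^bold>\<or> rel ap y z)))"

end

theory Submission
  imports Defs "HOL-Library.FSet"
begin

text \<open>
  Given \<open>x\<close> below \<open>y\<close> and a proposition \<open>p\<close>, let \<open>s\<close> be the supremum of the directed set that
  contains \<open>x\<close> and, on condition \<open>p\<close>, also \<open>y\<close>. If \<open>p\<close> holds then \<open>s = y\<close>, and if \<open>p\<close> fails then
  \<open>s = x\<close>. For (i), \<open>\<not>\<not>p\<close> excludes that \<open>s\<close> is apart from \<open>y\<close>, so tightness gives \<open>s = y\<close> and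
  strictness gives \<open>p\<close>; apply this to a \<open>p\<close> equivalent to \<open>A \<or> \<not>A\<close>, whose double negation is
  provable. For (ii), \<open>s\<close> is apart from \<open>x\<close>, whence \<open>\<not>\<not>p\<close>, or from \<open>y\<close>, whence \<open>\<not>p\<close>.

  Derivability from finite contexts behaves as forcing over the contexts ordered by inclusion, with
  covers for disjunction and existence. So the argument is carried out in HOL about contexts, after
  the forcing clauses have replaced the connectives of the object logic.
\<close>

section \<open>Renaming and weakening\<close>

lemma case_nat_id [simp]: "case_nat 0 Suc = (\<lambda>k. k)"
  by (auto split: nat.split)

lemma rename_id [simp]: "rename (\<lambda>k. k) A = A"
  by (induction A) simp_all

lemma rename_rename: "rename f (rename g A) = rename (\<lambda>k. f (g k)) A"
proof (induction A arbitrary: f g)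
  case (All A)
  have "(\<lambda>k. case_nat 0 (\<lambda>k. Suc (f k)) (case_nat 0 (\<lambda>k. Suc (g k)) k)) =
      case_nat 0 (\<lambda>k. Suc (f (g k)))"
    by (auto split: nat.split)
  then show ?case by (simp add: All)
next
  case (Ex A)
  have "(\<lambda>k. case_nat 0 (\<lambda>k. Suc (f k)) (case_nat 0 (\<lambda>k. Suc (g k)) k)) =
      case_nat 0 (\<lambda>k. Suc (f (g k)))"
    by (auto split: nat.split)
  then show ?case by (simp add: Ex)
qed simp_all

text \<open>Lifting \<open>f\<close> leaves index 0 free for \<open>t\<close>, so instantiating a
  renamed body is a single renaming by the extended environment \<open>case_nat t f\<close>. The
  quantifier clauses of forcing rest on this.\<close>

lemma subst0_rename: "subst0 t (rename (case_nat 0 (\<lambda>k. Suc (f k))) A) = rename (case_nat t f) A"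
  unfolding subst0_def rename_rename by (rule arg_cong2[of _ _ _ _ rename]) (auto split: nat.split)

lemma rename_subst0:
  "rename f (subst0 t A) = subst0 (f t) (rename (case_nat 0 (\<lambda>k. Suc (f k))) A)"
  unfolding subst0_rename unfolding subst0_def rename_rename
  by (rule arg_cong2[of _ _ _ _ rename]) (auto split: nat.split)

lemmas form_defs = mem_f_def eq_f_def conj_f_def disj_f_def imp_f_def iff_f_def not_f_def
  all_f_def ex_f_def empty_f_def scheme_def

text \<open>Renaming an instance of a scheme gives the instance for a formula with renamed parameters.\<close>

lemma rename_IZF: "A \<in> IZF \<Longrightarrow> rename f A \<in> IZF"
proof (induction rule: IZF.induct)
  case (separation A)
  let ?g = "case_nat 0 (\<lambda>k. Suc (f k))"
  have "rename f ((\<^bold>\<forall>a. \<^bold>\<exists>b. \<^bold>\<forall>x. x \<^bold>\<in> b \<^bold>\<longleftrightarrow> (x \<^bold>\<in> a \<^bold>\<and> scheme A [x])) 0) =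
      (\<^bold>\<forall>a. \<^bold>\<exists>b. \<^bold>\<forall>x. x \<^bold>\<in> b \<^bold>\<longleftrightarrow> (x \<^bold>\<in> a \<^bold>\<and> scheme (rename ?g A) [x])) 0"
    by (simp add: form_defs rename_rename)
      (rule arg_cong2[of _ _ _ _ rename], auto split: nat.split)
  then show ?case using IZF.separation by simp
next
  case (collection A)
  \<comment> \<open>\<open>A\<close> reserves the indices 0 and 1 for \<open>x\<close> and
    \<open>y\<close>, so \<open>f\<close> is lifted twice to act on the parameters alone.\<close>
  let ?g = "case_nat 0 (\<lambda>k. Suc (case_nat 0 (\<lambda>k. Suc (f k)) k))"
  have "rename f ((\<^bold>\<forall>a. (\<^bold>\<forall>x. x \<^bold>\<in> a \<^bold>\<longrightarrow> (\<^bold>\<exists>y. scheme A [x, y])) \<^bold>\<longrightarrow>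
        (\<^bold>\<exists>b. \<^bold>\<forall>x. x \<^bold>\<in> a \<^bold>\<longrightarrow> (\<^bold>\<exists>y. y \<^bold>\<in> b \<^bold>\<and> scheme A [x, y]))) 0) =
      (\<^bold>\<forall>a. (\<^bold>\<forall>x. x \<^bold>\<in> a \<^bold>\<longrightarrow> (\<^bold>\<exists>y. scheme (rename ?g A) [x, y])) \<^bold>\<longrightarrow>
        (\<^bold>\<exists>b. \<^bold>\<forall>x. x \<^bold>\<in> a \<^bold>\<longrightarrow> (\<^bold>\<exists>y. y \<^bold>\<in> b \<^bold>\<and> scheme (rename ?g A) [x, y]))) 0"
    by (simp add: form_defs rename_rename)
      (intro conjI; rule arg_cong2[of _ _ _ _ rename]; auto split: nat.split)
  then show ?case using IZF.collection by simp
next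
  case (set_induction A)
  let ?g = "case_nat 0 (\<lambda>k. Suc (f k))"
  have "rename f (((\<^bold>\<forall>x. (\<^bold>\<forall>y. y \<^bold>\<in> x \<^bold>\<longrightarrow> scheme A [y]) \<^bold>\<longrightarrow> scheme A [x]) \<^bold>\<longrightarrow>
        (\<^bold>\<forall>x. scheme A [x])) 0) =
      ((\<^bold>\<forall>x. (\<^bold>\<forall>y. y \<^bold>\<in> x \<^bold>\<longrightarrow> scheme (rename ?g A) [y]) \<^bold>\<longrightarrow> scheme (rename ?g A) [x]) \<^bold>\<longrightarrow>
        (\<^bold>\<forall>x. scheme (rename ?g A) [x])) 0"
    by (simp add: form_defs rename_rename)
      (intro conjI; rule arg_cong2[of _ _ _ _ rename]; auto split: nat.split)
  then show ?case using IZF.set_induction by simp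
next
  \<comment> \<open>The remaining axioms are closed formulas, which every renaming fixes.\<close>
  case extensionality
  show ?case using IZF.extensionality by (simp add: form_defs numeral_eq_Suc)
next
  case pairing
  show ?case using IZF.pairing by (simp add: form_defs numeral_eq_Suc)
next
  case union
  show ?case using IZF.union by (simp add: form_defs numeral_eq_Suc)
next
  case powerset
  show ?case using IZF.powerset by (simp add: form_defs numeral_eq_Suc)
next
  case infinity
  show ?case using IZF.infinity by (simp add: form_defs numeral_eq_Suc)
qed

text \<open>Any map \<open>f\<close> will do, as the de Bruijn rules carry no freshness condition.
  Under a quantifier the induction hypothesis is used at the lift of \<open>f\<close>; the lift
  after \<open>Suc\<close> equals \<open>Suc\<close> after \<open>f\<close>, so the shifted context
  keeps its shape.\<close>

lemma deriv_rename: "G \<turnstile> A \<Longrightarrow> rename f ` G \<turnstile> rename f A"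
proof (induction arbitrary: f rule: deriv.induct)
  case (Axiom A G)
  then show ?case by (blast intro: deriv.Axiom rename_IZF)
next
  case (DisjE G A B C)
  then have "rename f ` G \<turnstile> Disj (rename f A) (rename f B)"
    and "insert (rename f A) (rename f ` G) \<turnstile> rename f C"
    and "insert (rename f B) (rename f ` G) \<turnstile> rename f C"
    by (simp_all flip: image_insert)
  then show ?case by (rule deriv.DisjE)
next
  case (AllI G A)
  from AllI.IH[of "case_nat 0 (\<lambda>k. Suc (f k))"] show ?case
    by (simp add: deriv.AllI image_image rename_rename)
next
  case (AllE G A t)
  then show ?case by (metis deriv.AllE rename.simps(7) rename_subst0)
next
  case (ExI G t A)
  then show ?case by (metis deriv.ExI rename.simps(8) rename_subst0)
next
  case (ExE G A C)
  show ?case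
  proof (rule deriv.ExE)
    show "rename f ` G \<turnstile> Ex (rename (case_nat 0 (\<lambda>k. Suc (f k))) A)"
      using ExE.IH(1)[of f] by simp
    show "insert (rename (case_nat 0 (\<lambda>k. Suc (f k))) A) (rename Suc ` rename f ` G)
        \<turnstile> rename Suc (rename f C)"
      using ExE.IH(2)[of "case_nat 0 (\<lambda>k. Suc (f k))"]
      by (simp add: image_image rename_rename)
  qed
next
  case (EqlE G s t A)
  then show ?case by (metis deriv.EqlE rename.simps(2) rename_subst0)
next
  case (ImpE G A B)
  then show ?case by (metis deriv.ImpE rename.simps(6))
next
  case (BotE G A)
  then show ?case by (metis deriv.BotE rename.simps(3))
next
  case (ConjE1 G A B)
  then show ?case by (metis deriv.ConjE1 rename.simps(4))
next
  case (ConjE2 G A B)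
  then show ?case by (metis deriv.ConjE2 rename.simps(4))
next
  case (ImpI A G B)
  from ImpI.IH[of f] show ?case by (simp add: deriv.ImpI)
qed (simp_all add: deriv.Assm deriv.ConjI deriv.DisjI1 deriv.DisjI2 deriv.EqlI)

lemma deriv_mono: "G \<turnstile> A \<Longrightarrow> G \<subseteq> H \<Longrightarrow> H \<turnstile> A"
proof (induction arbitrary: H rule: deriv.induct)
  case (DisjE G A B C)
  then show ?case by (meson deriv.DisjE insert_mono)
next
  case (ImpI A G B)
  then show ?case by (meson deriv.ImpI insert_mono)
next
  case (ImpE G A B)
  then show ?case by (meson deriv.ImpE)
next
  case (AllI G A)
  then show ?case by (meson deriv.AllI image_mono)
next
  case (ExE G A C)
  then show ?case by (meson deriv.ExE image_mono insert_mono)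
next
  case (EqlE G s t A)
  then show ?case by (meson deriv.EqlE)
next
  case (BotE G A)
  then show ?case by (meson deriv.BotE)
next
  case (ConjE1 G A B)
  then show ?case by (meson deriv.ConjE1)
next
  case (ConjE2 G A B)
  then show ?case by (meson deriv.ConjE2)
next
  case (AllE G A t)
  then show ?case by (meson deriv.AllE)
next
  case (ExI G t A)
  then show ?case by (meson deriv.ExI)
next
  case (Assm A G)
  then show ?case by (meson deriv.Assm subsetD)
qed (simp_all add: deriv.Axiom deriv.ConjI deriv.DisjI1 deriv.DisjI2 deriv.EqlI)

section \<open>Quantifier rules over finite contexts\<close>

primrec free_below :: "nat \<Rightarrow> fm \<Rightarrow> bool" where
  "free_below m (Mem i j) = (i < m \<and> j < m)"
| "free_below m (Eql i j) = (i < m \<and> j < m)"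
| "free_below m Bot = True"
| "free_below m (Conj A B) = (free_below m A \<and> free_below m B)"
| "free_below m (Disj A B) = (free_below m A \<and> free_below m B)"
| "free_below m (Imp A B) = (free_below m A \<and> free_below m B)"
| "free_below m (All A) = free_below (Suc m) A"
| "free_below m (Ex A) = free_below (Suc m) A"

lemma free_below_mono: "free_below m A \<Longrightarrow> m \<le> n \<Longrightarrow> free_below n A"
  by (induction A arbitrary: m n) force+

lemma free_below_exists: "\<exists>m. free_below m A"
proof (induction A)
  case (Mem i j)
  show ?case by (rule exI[of _ "Suc (i + j)"]) simp
next
  case (Eql i j)
  show ?case by (rule exI[of _ "Suc (i + j)"]) simp
next
  case (Conj A B)
  then show ?case by (metis free_below.simps(4) free_below_mono nat_le_linear)
next
  case (Disj A B)
  then show ?case by (metis free_below.simps(5) free_below_mono nat_le_linear)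
next
  case (Imp A B)
  then show ?case by (metis free_below.simps(6) free_below_mono nat_le_linear)
next
  case (All A)
  then show ?case by (metis free_below.simps(7) free_below_mono le_SucI order_refl)
next
  case (Ex A)
  then show ?case by (metis free_below.simps(8) free_below_mono le_SucI order_refl)
qed simp

lemma free_below_finite: "finite G \<Longrightarrow> \<exists>m. \<forall>A\<in>G. free_below m A"
proof (induction G rule: finite_induct)
  case (insert A G)
  then show ?case
    using free_below_exists[of A] by (metis free_below_mono insert_iff nat_le_linear)
qed simp

lemma rename_cong: "free_below m A \<Longrightarrow> (\<And>k. k < m \<Longrightarrow> f k = g k) \<Longrightarrow> rename f A = rename g A"
proof (induction A arbitrary: m f g)
  case (Conj A B)
  from Conj.IH[of m f g] Conj.prems show ?case by simp
next
  case (Disj A B)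
  from Disj.IH[of m f g] Disj.prems show ?case by simp
next
  case (Imp A B)
  from Imp.IH[of m f g] Imp.prems show ?case by simp
next
  case (All A)
  have "rename (case_nat 0 (\<lambda>k. Suc (f k))) A = rename (case_nat 0 (\<lambda>k. Suc (g k))) A"
    using All.prems by (intro All.IH[of "Suc m"]) (auto split: nat.split)
  then show ?case by simp
next
  case (Ex A)
  have "rename (case_nat 0 (\<lambda>k. Suc (f k))) A = rename (case_nat 0 (\<lambda>k. Suc (g k))) A"
    using Ex.prems by (intro Ex.IH[of "Suc m"]) (auto split: nat.split)
  then show ?case by simp
qed simp_all

text \<open>The inverse of substituting a fresh \<open>y\<close> for index 0.\<close>

definition unsubst :: "nat \<Rightarrow> fm \<Rightarrow> fm" where
  "unsubst y = rename (\<lambda>k. if k = y then 0 else Suc k)"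

lemma unsubst_subst0: "free_below y A \<Longrightarrow> unsubst y (subst0 y A) = A"
proof -
  assume "free_below y A"
  then have "unsubst y (subst0 y A) = rename (\<lambda>k. k) A"
    unfolding unsubst_def subst0_def rename_rename
    by (intro rename_cong[of y]) (auto split: nat.split)
  then show ?thesis by simp
qed

lemma unsubst_fresh: "free_below y A \<Longrightarrow> unsubst y A = rename Suc A"
  unfolding unsubst_def by (rule rename_cong) auto

text \<open>
  Renaming a derivation with \<open>unsubst\<close> turns an instance for a fresh variable into the premise of the
  de Bruijn rule. As a finite context leaves some variable fresh, asking for all instances suffices
  and no freshness conditions appear.
\<close>

lemma AllI_finite:
  assumes "finite G" and "\<And>y. G \<turnstile> subst0 y A"
  shows "G \<turnstile> All A"
proof (rule deriv.AllI)
  from free_below_finite[of "insert A G"] assms(1)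
  obtain y where y: "\<forall>B\<in>insert A G. free_below y B" by auto
  have "unsubst y ` G \<turnstile> unsubst y (subst0 y A)"
    unfolding unsubst_def by (intro deriv_rename assms(2))
  moreover have "unsubst y ` G = rename Suc ` G"
    using y by (intro image_cong) (auto simp: unsubst_fresh)
  ultimately show "rename Suc ` G \<turnstile> A"
    using y by (simp add: unsubst_subst0)
qed

lemma ExE_finite:
  assumes "finite G" and "G \<turnstile> Ex A" and "\<And>y. insert (subst0 y A) G \<turnstile> C"
  shows "G \<turnstile> C"
proof (rule deriv.ExE[OF assms(2)])
  \<comment> \<open>Here \<open>C\<close> must be free of \<open>y\<close> as well, so that
    \<open>unsubst y\<close> shifts it as the rule demands.\<close>
  from free_below_finite[of "insert A (insert C G)"] assms(1)
  obtain y where y: "\<forall>B\<in>insert A (insert C G). free_below y B" by auto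
  have "unsubst y ` insert (subst0 y A) G \<turnstile> unsubst y C"
    unfolding unsubst_def by (intro deriv_rename assms(3))
  moreover have "unsubst y ` G = rename Suc ` G"
    using y by (intro image_cong) (auto simp: unsubst_fresh)
  ultimately show "insert A (rename Suc ` G) \<turnstile> rename Suc C"
    using y by (simp add: unsubst_subst0 unsubst_fresh)
qed

section \<open>Derivability as forcing\<close>

text \<open>The contexts are finite so that a fresh variable is always at hand for the quantifier
  rules. Inclusion of contexts is the order of the stages.\<close>

definition forces :: "fm fset \<Rightarrow> fm \<Rightarrow> bool" (infix "\<tturnstile>" 55) where
  "G \<tturnstile> A \<longleftrightarrow> fset G \<turnstile> A"

text \<open>An impredicative encoding of covers: a formula forced at all stages above
  \<open>G\<close> with property \<open>P\<close> is forced at \<open>G\<close>. Quantifying over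
  \<open>C\<close> replaces an inductive generation of covers by disjunctions and
  existentials.\<close>

definition covered :: "fm fset \<Rightarrow> (fm fset \<Rightarrow> bool) \<Rightarrow> bool" where
  "covered G P \<longleftrightarrow> (\<forall>C. (\<forall>H\<ge>G. P H \<longrightarrow> H \<tturnstile> C) \<longrightarrow> G \<tturnstile> C)"

lemma forces_mono: "G \<tturnstile> A \<Longrightarrow> G \<le> H \<Longrightarrow> H \<tturnstile> A"
  unfolding forces_def by (erule deriv_mono) (simp add: less_eq_fset.rep_eq)

lemma forces_finsert: "finsert A G \<tturnstile> A"
  unfolding forces_def by (simp add: deriv.Assm)

lemma covered_forces: "covered G P \<Longrightarrow> (\<And>H. G \<le> H \<Longrightarrow> P H \<Longrightarrow> H \<tturnstile> C) \<Longrightarrow> G \<tturnstile> C"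
  unfolding covered_def by blast

text \<open>Transitivity of covers. Disjunctions and existentials can thus be eliminated one after
  another while the goal is itself a cover.\<close>

lemma covered_bind:
  "covered G P \<Longrightarrow> (\<And>H. G \<le> H \<Longrightarrow> P H \<Longrightarrow> covered H Q) \<Longrightarrow> covered G Q"
  unfolding covered_def by (meson order_trans)

lemma covered_mono: "covered G P \<Longrightarrow> (\<And>H. G \<le> H \<Longrightarrow> P H \<Longrightarrow> Q H) \<Longrightarrow> covered G Q"
  unfolding covered_def by blast

lemma coveredI: "P G \<Longrightarrow> covered G P"
  unfolding covered_def by blast

lemma forces_Conj: "G \<tturnstile> Conj A B \<longleftrightarrow> G \<tturnstile> A \<and> G \<tturnstile> B"
  unfolding forces_def by (meson deriv.ConjI deriv.ConjE1 deriv.ConjE2)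

lemma forces_Imp: "G \<tturnstile> Imp A B \<longleftrightarrow> (\<forall>H\<ge>G. H \<tturnstile> A \<longrightarrow> H \<tturnstile> B)"
proof
  assume "G \<tturnstile> Imp A B"
  then show "\<forall>H\<ge>G. H \<tturnstile> A \<longrightarrow> H \<tturnstile> B"
    by (meson forces_def forces_mono deriv.ImpE)
next
  assume "\<forall>H\<ge>G. H \<tturnstile> A \<longrightarrow> H \<tturnstile> B"
  \<comment> \<open>Among the extensions of \<open>G\<close>, the one by \<open>A\<close> itself
    suffices for \<open>ImpI\<close>.\<close>
  then have "finsert A G \<tturnstile> B" using forces_finsert by (metis fsubset_finsertI)
  then show "G \<tturnstile> Imp A B" unfolding forces_def by (simp add: deriv.ImpI)
qed

lemma forces_Bot: "G \<tturnstile> Bot \<Longrightarrow> G \<tturnstile> A"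
  unfolding forces_def by (rule deriv.BotE)

text \<open>From left to right, the assumption on \<open>C\<close> is used at the extensions by
  \<open>A\<close> and by \<open>B\<close>, as in \<open>DisjE\<close>. From right to left, the
  disjunction itself is taken for \<open>C\<close>.\<close>

lemma forces_Disj: "G \<tturnstile> Disj A B \<longleftrightarrow> covered G (\<lambda>H. H \<tturnstile> A \<or> H \<tturnstile> B)"
proof
  assume *: "G \<tturnstile> Disj A B"
  show "covered G (\<lambda>H. H \<tturnstile> A \<or> H \<tturnstile> B)"
    unfolding covered_def
  proof (intro allI impI)
    fix C assume C: "\<forall>H\<ge>G. H \<tturnstile> A \<or> H \<tturnstile> B \<longrightarrow> H \<tturnstile> C"
    have "finsert A G \<tturnstile> C" "finsert B G \<tturnstile> C"
      using C forces_finsert by (metis fsubset_finsertI)+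
    with * show "G \<tturnstile> C" unfolding forces_def by (auto intro: deriv.DisjE)
  qed
next
  assume "covered G (\<lambda>H. H \<tturnstile> A \<or> H \<tturnstile> B)"
  then show "G \<tturnstile> Disj A B"
    by (rule covered_forces) (auto simp: forces_def intro: deriv.DisjI1 deriv.DisjI2)
qed

text \<open>Variables are the only terms, so \<open>y\<close> runs through all instances. The clause
  can stay at the stage \<open>G\<close> because each instance persists to later stages.\<close>

lemma forces_All: "G \<tturnstile> rename e (All A) \<longleftrightarrow> (\<forall>y. G \<tturnstile> rename (case_nat y e) A)"
  unfolding forces_def rename.simps
  by (metis AllI_finite deriv.AllE finite_fset subst0_rename)

lemma forces_Ex:
  "G \<tturnstile> rename e (Ex A) \<longleftrightarrow> covered G (\<lambda>H. \<exists>y. H \<tturnstile> rename (case_nat y e) A)"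
proof
  assume *: "G \<tturnstile> rename e (Ex A)"
  show "covered G (\<lambda>H. \<exists>y. H \<tturnstile> rename (case_nat y e) A)"
    unfolding covered_def
  proof (intro allI impI)
    fix C assume C: "\<forall>H\<ge>G. (\<exists>y. H \<tturnstile> rename (case_nat y e) A) \<longrightarrow> H \<tturnstile> C"
    have "finsert (rename (case_nat y e) A) G \<tturnstile> C" for y
      using C forces_finsert by (metis fsubset_finsertI)
    with * show "G \<tturnstile> C" unfolding forces_def
      by (auto intro: ExE_finite simp: subst0_rename)
  qed
next
  assume "covered G (\<lambda>H. \<exists>y. H \<tturnstile> rename (case_nat y e) A)"
  then show "G \<tturnstile> rename e (Ex A)"
    by (rule covered_forces) (metis deriv.ExI forces_def rename.simps(8) subst0_rename)
qed

lemma forces_Eql: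
  "G \<tturnstile> Eql s t \<Longrightarrow> G \<tturnstile> rename (case_nat s e) A \<Longrightarrow> G \<tturnstile> rename (case_nat t e) A"
  unfolding forces_def by (metis deriv.EqlE subst0_rename)

lemma forces_Eql_refl: "G \<tturnstile> Eql t t"
  unfolding forces_def by (rule deriv.EqlI)

lemma forces_Eql_sym: "G \<tturnstile> Eql s t \<Longrightarrow> G \<tturnstile> Eql t s"
  \<comment> \<open>With index 1 read as \<open>s\<close>, the formula \<open>Eql 0 1\<close>
    becomes \<open>Eql s s\<close> or \<open>Eql t s\<close>, according as index 0 is
    \<open>s\<close> or \<open>t\<close>.\<close>
  using forces_Eql[of G s t "\<lambda>k. s" "Eql 0 1"] by (simp add: forces_Eql_refl)

lemma forces_IZF: "A \<in> IZF \<Longrightarrow> G \<tturnstile> A"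
  unfolding forces_def by (rule deriv.Axiom)


section \<open>Forcing of forms\<close>

text \<open>The level \<open>x < n\<close> is interpreted by the variable \<open>\<rho> x\<close>, the parameters by themselves.\<close>

definition env :: "(nat \<Rightarrow> nat) \<Rightarrow> nat \<Rightarrow> nat \<Rightarrow> nat" where
  "env \<rho> n k = (if k < n then \<rho> (n - Suc k) else k - n)"

definition at :: "(nat \<Rightarrow> nat) \<Rightarrow> nat \<Rightarrow> form \<Rightarrow> fm" where
  "at \<rho> n A = rename (env \<rho> n) (A n)"

lemma env_0: "env \<rho> 0 = (\<lambda>k. k)"
  by (rule ext) (simp add: env_def)

text \<open>The quantifier at depth \<open>n\<close> binds level \<open>n\<close>, which is index 0
  at depth \<open>Suc n\<close>. So an update of \<rho> at \<open>n\<close> matches the extended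
  environment in the quantifier clauses.\<close>

lemma env_Suc: "env (\<rho>(n := y)) (Suc n) = case_nat y (env \<rho> n)"
  by (rule ext) (auto simp: env_def split: nat.split)

lemma at_mem: "x < n \<Longrightarrow> y < n \<Longrightarrow> at \<rho> n (x \<^bold>\<in> y) = Mem (\<rho> x) (\<rho> y)"
  by (simp add: at_def env_def mem_f_def)

lemma at_eq: "x < n \<Longrightarrow> y < n \<Longrightarrow> at \<rho> n (x \<^bold>= y) = Eql (\<rho> x) (\<rho> y)"
  by (simp add: at_def env_def eq_f_def)

lemma at_conj: "at \<rho> n (A \<^bold>\<and> B) = Conj (at \<rho> n A) (at \<rho> n B)"
  by (simp add: at_def conj_f_def)

lemma at_disj: "at \<rho> n (A \<^bold>\<or> B) = Disj (at \<rho> n A) (at \<rho> n B)"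
  by (simp add: at_def disj_f_def)

lemma at_imp: "at \<rho> n (A \<^bold>\<longrightarrow> B) = Imp (at \<rho> n A) (at \<rho> n B)"
  by (simp add: at_def imp_f_def)

lemma at_Bot: "at \<rho> n (\<lambda>n. Bot) = Bot"
  by (simp add: at_def)

lemma forces_all: "G \<tturnstile> at \<rho> n (all_f F) \<longleftrightarrow> (\<forall>y. G \<tturnstile> at (\<rho>(n := y)) (Suc n) (F n))"
  unfolding at_def all_f_def forces_All env_Suc ..

lemma forces_ex:
  "G \<tturnstile> at \<rho> n (ex_f F) \<longleftrightarrow> covered G (\<lambda>H. \<exists>y. H \<tturnstile> at (\<rho>(n := y)) (Suc n) (F n))"
  unfolding at_def ex_f_def forces_Ex env_Suc ..

lemma forces_at_Eql:
  "G \<tturnstile> Eql s t \<Longrightarrow> G \<tturnstile> at (\<rho>(n := s)) (Suc n) A \<Longrightarrow> G \<tturnstile> at (\<rho>(n := t)) (Suc n) A"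
  unfolding at_def env_Suc by (rule forces_Eql)

text \<open>\<open>scheme\<close> raises the parameters by \<open>n\<close> and \<open>env\<close>
  lowers them again, which leaves the decrease by one that \<open>subst0\<close> makes.\<close>

lemma at_scheme: "x < n \<Longrightarrow> at \<rho> n (scheme A [x]) = subst0 (\<rho> x) A"
  unfolding at_def scheme_def subst0_def rename_rename
  by (rule arg_cong2[of _ _ _ _ rename]) (auto simp: env_def split: nat.split)

lemmas forces_simps = at_mem at_eq at_conj at_disj at_imp at_Bot forces_all forces_ex
  forces_Conj forces_Disj forces_Imp iff_f_def not_f_def

section \<open>Formulas for the notions at given variables\<close>

definition inst :: "form \<Rightarrow> nat list \<Rightarrow> fm" where
  "inst A xs = at (nth xs) (length xs) A"

definition empty_at :: "nat \<Rightarrow> fm" where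
  "empty_at e = inst (empty_f 0) [e]"

definition prop_at :: "nat \<Rightarrow> fm" where
  "prop_at p = inst (is_prop 0) [p]"

definition holds_at :: "nat \<Rightarrow> fm" where
  "holds_at p = inst (holds 0) [p]"

definition rel_at :: "nat \<Rightarrow> nat \<Rightarrow> nat \<Rightarrow> fm" where
  "rel_at r x y = inst (rel 0 1 2) [r, x, y]"

definition sup_at :: "nat \<Rightarrow> nat \<Rightarrow> nat \<Rightarrow> nat \<Rightarrow> fm" where
  "sup_at D le S s = inst (is_sup 0 1 2 3) [D, le, S, s]"

definition cond_at :: "nat \<Rightarrow> nat \<Rightarrow> nat \<Rightarrow> nat \<Rightarrow> fm" where
  "cond_at S x z p = inst (is_cond_set 0 1 2 3) [S, x, z, p]"

definition dcpo_at :: "nat \<Rightarrow> nat \<Rightarrow> fm" where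
  "dcpo_at D le = inst (dcpo 0 1) [D, le]"

definition strictly_below_at :: "nat \<Rightarrow> nat \<Rightarrow> nat \<Rightarrow> nat \<Rightarrow> fm" where
  "strictly_below_at D le x y = inst (strictly_below 0 1 2 3) [D, le, x, y]"

definition apartness_at :: "nat \<Rightarrow> nat \<Rightarrow> fm" where
  "apartness_at D ap = inst (apartness 0 1) [D, ap]"

definition tight_at :: "nat \<Rightarrow> nat \<Rightarrow> fm" where
  "tight_at D ap = inst (tight 0 1) [D, ap]"

definition cotransitive_at :: "nat \<Rightarrow> nat \<Rightarrow> fm" where
  "cotransitive_at D ap = inst (cotransitive 0 1) [D, ap]"

abbreviation neg :: "fm \<Rightarrow> fm" where
  "neg A \<equiv> Imp A Bot"

text \<open>Depth and levels do not matter, only the variables that the arguments denote. This lemma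
  and its analogues below replace each nested occurrence of a notion by one canonical formula, its
  instance at the first levels; the side conditions keep the arguments in scope.\<close>

lemma forces_empty: "e < n \<Longrightarrow> G \<tturnstile> at \<rho> n (empty_f e) \<longleftrightarrow> G \<tturnstile> empty_at (\<rho> e)"
  unfolding empty_at_def inst_def empty_f_def
  by (simp add: forces_simps)

lemma forces_prop: "p < n \<Longrightarrow> G \<tturnstile> at \<rho> n (is_prop p) \<longleftrightarrow> G \<tturnstile> prop_at (\<rho> p)"
  unfolding prop_at_def inst_def is_prop_def
  by (simp add: forces_simps forces_empty)

lemma forces_prop_at:
  "G \<tturnstile> prop_at p \<longleftrightarrow> (\<forall>w. \<forall>H\<ge>G. H \<tturnstile> Mem w p \<longrightarrow> H \<tturnstile> empty_at w)"
  unfolding prop_at_def inst_def is_prop_def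
  by (simp add: forces_simps forces_empty)

lemma forces_holds: "p < n \<Longrightarrow> G \<tturnstile> at \<rho> n (holds p) \<longleftrightarrow> G \<tturnstile> holds_at (\<rho> p)"
  unfolding holds_at_def inst_def holds_def
  by (simp add: forces_simps forces_empty)

lemma forces_holds_at:
  "G \<tturnstile> holds_at p \<longleftrightarrow> covered G (\<lambda>H. \<exists>e. H \<tturnstile> empty_at e \<and> H \<tturnstile> Mem e p)"
  unfolding holds_at_def inst_def holds_def
  by (simp add: forces_simps forces_empty)

lemma forces_rel:
  "r < n \<Longrightarrow> x < n \<Longrightarrow> y < n \<Longrightarrow> G \<tturnstile> at \<rho> n (rel r x y) \<longleftrightarrow> G \<tturnstile> rel_at (\<rho> r) (\<rho> x) (\<rho> y)"
  unfolding rel_at_def inst_def rel_def is_pair_def is_upair_def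
  by (simp add: forces_simps)

lemma forces_rel_at_Eql:
  assumes "G \<tturnstile> Eql x x'" and "G \<tturnstile> Eql y y'" and "G \<tturnstile> rel_at r x y"
  shows "G \<tturnstile> rel_at r x' y'"
proof -
  have "G \<tturnstile> rel_at r x' y"
    \<comment> \<open>The replaced variable sits at the top level, here 2, so
      \<open>rel 0 2 1\<close> puts the first argument there. The second use does the same for the
      other argument.\<close>
    using forces_at_Eql[OF assms(1), of "\<lambda>k. if k = 0 then r else y" 2 "rel 0 2 1"] assms(3)
    by (simp add: forces_rel)
  then show ?thesis
    using forces_at_Eql[OF assms(2), of "\<lambda>k. if k = 0 then r else x'" 2 "rel 0 1 2"]
    by (simp add: forces_rel)
qed

lemma forces_sup:
  "D < n \<Longrightarrow> le < n \<Longrightarrow> S < n \<Longrightarrow> s < n \<Longrightarrow>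
    G \<tturnstile> at \<rho> n (is_sup D le S s) \<longleftrightarrow> G \<tturnstile> sup_at (\<rho> D) (\<rho> le) (\<rho> S) (\<rho> s)"
  unfolding sup_at_def inst_def is_sup_def
  by (simp add: forces_simps forces_rel)

lemma forces_sup_at:
  "G \<tturnstile> sup_at D le S s \<longleftrightarrow> G \<tturnstile> Mem s D \<and>
    (\<forall>a. \<forall>H\<ge>G. H \<tturnstile> Mem a S \<longrightarrow> H \<tturnstile> rel_at le a s) \<and>
    (\<forall>u. \<forall>H\<ge>G. H \<tturnstile> Mem u D \<longrightarrow>
      (\<forall>K\<ge>H. (\<forall>a. \<forall>L\<ge>K. L \<tturnstile> Mem a S \<longrightarrow> L \<tturnstile> rel_at le a u) \<longrightarrow> K \<tturnstile> rel_at le s u))"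
  unfolding sup_at_def inst_def is_sup_def
  by (simp add: forces_simps forces_rel)

lemma sup_at_Eql: "G \<tturnstile> Eql s t \<Longrightarrow> G \<tturnstile> sup_at D le S s \<Longrightarrow> G \<tturnstile> sup_at D le S t"
  using forces_at_Eql[of G s t "nth [D, le, S]" 3 "is_sup 0 1 2 3"]
  by (simp add: forces_sup)

lemma forces_cond:
  "S < n \<Longrightarrow> x < n \<Longrightarrow> z < n \<Longrightarrow> p < n \<Longrightarrow>
    G \<tturnstile> at \<rho> n (is_cond_set S x z p) \<longleftrightarrow> G \<tturnstile> cond_at (\<rho> S) (\<rho> x) (\<rho> z) (\<rho> p)"
  unfolding cond_at_def inst_def is_cond_set_def
  by (simp add: forces_simps forces_holds)

lemma forces_cond_at:
  "G \<tturnstile> cond_at S x z p \<longleftrightarrow> (\<forall>w. \<forall>H\<ge>G. H \<tturnstile> Mem w S \<longleftrightarrow>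
    covered H (\<lambda>K. K \<tturnstile> Eql w x \<or> K \<tturnstile> Eql w z \<and> K \<tturnstile> holds_at p))"
  unfolding cond_at_def inst_def is_cond_set_def
  by (simp add: forces_simps forces_holds) blast

lemma forces_dcpo:
  "D < n \<Longrightarrow> le < n \<Longrightarrow> G \<tturnstile> at \<rho> n (dcpo D le) \<longleftrightarrow> G \<tturnstile> dcpo_at (\<rho> D) (\<rho> le)"
  unfolding dcpo_at_def inst_def dcpo_def poset_def relation_on_def subset_f_def directed_def
    is_pair_def is_upair_def
  by (simp add: forces_simps forces_rel forces_sup)

lemma forces_strictly_below:
  "D < n \<Longrightarrow> le < n \<Longrightarrow> x < n \<Longrightarrow> y < n \<Longrightarrow> G \<tturnstile> at \<rho> n (strictly_below D le x y) \<longleftrightarrow>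
    G \<tturnstile> strictly_below_at (\<rho> D) (\<rho> le) (\<rho> x) (\<rho> y)"
  unfolding strictly_below_at_def inst_def strictly_below_def
  by (simp add: forces_simps forces_rel forces_sup forces_cond forces_prop forces_holds)

lemma forces_apartness:
  "D < n \<Longrightarrow> ap < n \<Longrightarrow> G \<tturnstile> at \<rho> n (apartness D ap) \<longleftrightarrow> G \<tturnstile> apartness_at (\<rho> D) (\<rho> ap)"
  unfolding apartness_at_def inst_def apartness_def relation_on_def is_pair_def is_upair_def
  by (simp add: forces_simps forces_rel)

lemma forces_tight:
  "D < n \<Longrightarrow> ap < n \<Longrightarrow> G \<tturnstile> at \<rho> n (tight D ap) \<longleftrightarrow> G \<tturnstile> tight_at (\<rho> D) (\<rho> ap)"
  unfolding tight_at_def inst_def tight_def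
  by (simp add: forces_simps forces_rel)

lemma forces_cotransitive:
  "D < n \<Longrightarrow> ap < n \<Longrightarrow>
    G \<tturnstile> at \<rho> n (cotransitive D ap) \<longleftrightarrow> G \<tturnstile> cotransitive_at (\<rho> D) (\<rho> ap)"
  unfolding cotransitive_at_def inst_def cotransitive_def
  by (simp add: forces_simps forces_rel)

lemma forces_excluded_middle:
  "G \<tturnstile> at \<rho> n excluded_middle \<longleftrightarrow>
    (\<forall>p. \<forall>H\<ge>G. H \<tturnstile> prop_at p \<longrightarrow> H \<tturnstile> Disj (holds_at p) (neg (holds_at p)))"
  unfolding excluded_middle_def
  by (simp add: forces_simps forces_prop forces_holds)

lemma forces_weak_excluded_middle:
  "G \<tturnstile> at \<rho> n weak_excluded_middle \<longleftrightarrow>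
    (\<forall>p. \<forall>H\<ge>G. H \<tturnstile> prop_at p \<longrightarrow> H \<tturnstile> Disj (neg (holds_at p)) (neg (neg (holds_at p))))"
  unfolding weak_excluded_middle_def
  by (simp add: forces_simps forces_prop forces_holds)

section \<open>Dcpos and apartness as rules for forcing\<close>

lemma dcpo_refl: "G \<tturnstile> dcpo_at D le \<Longrightarrow> G \<tturnstile> Mem x D \<Longrightarrow> G \<tturnstile> rel_at le x x"
  unfolding dcpo_at_def inst_def dcpo_def poset_def
  by (simp add: forces_simps forces_rel)

lemma dcpo_antisym:
  "G \<tturnstile> dcpo_at D le \<Longrightarrow> G \<tturnstile> Mem x D \<Longrightarrow> G \<tturnstile> Mem y D \<Longrightarrow> G \<tturnstile> rel_at le x y \<Longrightarrow>
    G \<tturnstile> rel_at le y x \<Longrightarrow> G \<tturnstile> Eql x y"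
  unfolding dcpo_at_def inst_def dcpo_def poset_def
  by (simp add: forces_simps forces_rel) blast

lemma dcpo_sup:
  assumes dcpo: "G \<tturnstile> dcpo_at D le"
    and sub: "\<And>H w. G \<le> H \<Longrightarrow> H \<tturnstile> Mem w S \<Longrightarrow> H \<tturnstile> Mem w D"
    and inh: "G \<tturnstile> Mem c S"
    and dir: "\<And>H a b. G \<le> H \<Longrightarrow> H \<tturnstile> Mem a S \<Longrightarrow> H \<tturnstile> Mem b S \<Longrightarrow>
      covered H (\<lambda>K. \<exists>c. K \<tturnstile> Mem c S \<and> K \<tturnstile> rel_at le a c \<and> K \<tturnstile> rel_at le b c)"
  shows "covered G (\<lambda>H. \<exists>s. H \<tturnstile> sup_at D le S s)"
proof -
  \<comment> \<open>In the unfolded clause every implication opens a further stage, and existence is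
    asserted through covers.\<close>
  have *: "\<forall>S. \<forall>H\<ge>G. (\<forall>w. \<forall>K\<ge>H. K \<tturnstile> Mem w S \<longrightarrow> K \<tturnstile> Mem w D) \<longrightarrow>
      (\<forall>H'\<ge>H. covered H' (\<lambda>K. \<exists>a. K \<tturnstile> Mem a S) \<and>
        (\<forall>a. \<forall>K\<ge>H'. K \<tturnstile> Mem a S \<longrightarrow> (\<forall>b. \<forall>L\<ge>K. L \<tturnstile> Mem b S \<longrightarrow>
          covered L (\<lambda>M. \<exists>c. M \<tturnstile> Mem c S \<and> M \<tturnstile> rel_at le a c \<and> M \<tturnstile> rel_at le b c))) \<longrightarrow>
        covered H' (\<lambda>K. \<exists>s. K \<tturnstile> sup_at D le S s))"
    using dcpo unfolding dcpo_at_def inst_def dcpo_def subset_f_def directed_def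
    by (simp add: forces_simps forces_rel forces_sup)
  have "covered G (\<lambda>K. \<exists>a. K \<tturnstile> Mem a S)"
    using inh by (blast intro: coveredI)
  moreover have "\<forall>a. \<forall>K\<ge>G. K \<tturnstile> Mem a S \<longrightarrow> (\<forall>b. \<forall>L\<ge>K. L \<tturnstile> Mem b S \<longrightarrow>
      covered L (\<lambda>M. \<exists>c. M \<tturnstile> Mem c S \<and> M \<tturnstile> rel_at le a c \<and> M \<tturnstile> rel_at le b c))"
    \<comment> \<open>\<open>b\<close> arrives at a later stage than \<open>a\<close>, so the
      membership of \<open>a\<close> is carried up before \<open>dir\<close> applies.\<close>
    using dir by (meson forces_mono order_trans)
  moreover have "\<forall>w. \<forall>K\<ge>G. K \<tturnstile> Mem w S \<longrightarrow> K \<tturnstile> Mem w D"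
    using sub by blast
  ultimately show ?thesis
    by (intro *[THEN spec, THEN spec, THEN mp, OF order_refl, THEN mp, THEN spec, THEN mp,
          OF _ order_refl, THEN mp] conjI)
qed

lemma strictly_below_rel: "G \<tturnstile> strictly_below_at D le x y \<Longrightarrow> G \<tturnstile> rel_at le x y"
  unfolding strictly_below_at_def inst_def strictly_below_def
  by (simp add: forces_simps forces_rel)

text \<open>Strictness speaks of all \<open>z\<close> above \<open>y\<close> and is applied to
  \<open>y\<close> itself, hence the assumption that \<open>y\<close> is below
  \<open>y\<close>.\<close>

lemma strictly_below_holds:
  assumes "G \<tturnstile> strictly_below_at D le x y" and "G \<tturnstile> Mem y D" and "G \<tturnstile> rel_at le y y"
    and "G \<tturnstile> prop_at p" and "G \<tturnstile> cond_at S x y p" and "G \<tturnstile> sup_at D le S y"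
  shows "G \<tturnstile> holds_at p"
proof -
  have "\<forall>z. \<forall>H\<ge>G. H \<tturnstile> Mem z D \<longrightarrow> (\<forall>K\<ge>H. K \<tturnstile> rel_at le y z \<longrightarrow> (\<forall>p. \<forall>L\<ge>K. L \<tturnstile> prop_at p \<longrightarrow>
      (\<forall>M\<ge>L. covered M (\<lambda>N. \<exists>S. N \<tturnstile> cond_at S x z p \<and> N \<tturnstile> sup_at D le S z) \<longrightarrow>
        M \<tturnstile> holds_at p)))"
    using assms(1) unfolding strictly_below_at_def inst_def strictly_below_def
    by (simp add: forces_simps forces_rel forces_sup forces_cond forces_prop forces_holds)
  moreover have "covered G (\<lambda>N. \<exists>S. N \<tturnstile> cond_at S x y p \<and> N \<tturnstile> sup_at D le S y)"
    using assms(5,6) by (blast intro: coveredI)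
  ultimately show ?thesis
    using assms(2-4) by blast
qed

lemma apartness_irrefl:
  "G \<tturnstile> apartness_at D ap \<Longrightarrow> G \<tturnstile> Mem x D \<Longrightarrow> G \<tturnstile> rel_at ap x x \<Longrightarrow> G \<tturnstile> Bot"
  unfolding apartness_at_def inst_def apartness_def
  by (simp add: forces_simps forces_rel) blast

lemma tight_Eql:
  "G \<tturnstile> tight_at D ap \<Longrightarrow> G \<tturnstile> Mem x D \<Longrightarrow> G \<tturnstile> Mem y D \<Longrightarrow> G \<tturnstile> neg (rel_at ap x y) \<Longrightarrow>
    G \<tturnstile> Eql x y"
  unfolding tight_at_def inst_def tight_def
  by (simp add: forces_simps forces_rel) blast

lemma cotransitive_cases:
  "G \<tturnstile> cotransitive_at D ap \<Longrightarrow> G \<tturnstile> Mem x D \<Longrightarrow> G \<tturnstile> Mem y D \<Longrightarrow> G \<tturnstile> Mem z D \<Longrightarrow>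
    G \<tturnstile> rel_at ap x y \<Longrightarrow> covered G (\<lambda>H. H \<tturnstile> rel_at ap x z \<or> H \<tturnstile> rel_at ap y z)"
  unfolding cotransitive_at_def inst_def cotransitive_def
  by (simp add: forces_simps forces_rel) blast

section \<open>Sets given by the axioms\<close>

lemma forces_axiom: "A 0 \<in> IZF \<Longrightarrow> G \<tturnstile> at \<rho> 0 A"
  by (simp add: at_def env_0 forces_IZF)

lemma pairing_exists:
  "covered G (\<lambda>H. \<exists>c. \<forall>w. \<forall>K\<ge>H. K \<tturnstile> Mem w c \<longleftrightarrow> covered K (\<lambda>L. L \<tturnstile> Eql w x \<or> L \<tturnstile> Eql w y))"
proof -
  have "G \<tturnstile> at id 0 (\<^bold>\<forall>a. \<^bold>\<forall>b. \<^bold>\<exists>c. \<^bold>\<forall>w. w \<^bold>\<in> c \<^bold>\<longleftrightarrow> (w \<^bold>= a \<^bold>\<or> w \<^bold>= b))"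
    by (rule forces_axiom, rule IZF.pairing)
  \<comment> \<open>The equivalence of the object logic unfolds into two implications over
    extensions, which are then merged into one equivalence at each stage.\<close>
  then have "covered G (\<lambda>H. \<exists>c. \<forall>w. (\<forall>K\<ge>H. K \<tturnstile> Mem w c \<longrightarrow> covered K (\<lambda>L. L \<tturnstile> Eql w x \<or> L \<tturnstile> Eql w y)) \<and>
      (\<forall>K\<ge>H. covered K (\<lambda>L. L \<tturnstile> Eql w x \<or> L \<tturnstile> Eql w y) \<longrightarrow> K \<tturnstile> Mem w c))"
    by (simp add: forces_simps)
  then show ?thesis
    by (rule covered_mono) blast
qed

lemma separation_exists:
  "covered G (\<lambda>H. \<exists>b. \<forall>x. \<forall>K\<ge>H. K \<tturnstile> Mem x b \<longleftrightarrow> K \<tturnstile> Mem x a \<and> K \<tturnstile> subst0 x A)"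
proof -
  have "G \<tturnstile> at id 0 (\<^bold>\<forall>a. \<^bold>\<exists>b. \<^bold>\<forall>x. x \<^bold>\<in> b \<^bold>\<longleftrightarrow> (x \<^bold>\<in> a \<^bold>\<and> scheme A [x]))"
    by (rule forces_axiom, rule IZF.separation)
  then have "covered G (\<lambda>H. \<exists>b. \<forall>x.
      (\<forall>K\<ge>H. K \<tturnstile> Mem x b \<longrightarrow> K \<tturnstile> Mem x a \<and> K \<tturnstile> subst0 x A) \<and>
      (\<forall>K\<ge>H. K \<tturnstile> Mem x a \<and> K \<tturnstile> subst0 x A \<longrightarrow> K \<tturnstile> Mem x b))"
    by (simp add: forces_simps at_scheme)
  then show ?thesis
    by (rule covered_mono) blast
qed

text \<open>Infinity provides an empty set together with a set that contains it, from which
  propositions can be separated.\<close>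

lemma empty_member_exists: "covered G (\<lambda>H. \<exists>a e. H \<tturnstile> Mem e a \<and> H \<tturnstile> empty_at e)"
proof -
  have "G \<tturnstile> at id 0 (\<^bold>\<exists>a. (\<^bold>\<exists>e. e \<^bold>\<in> a \<^bold>\<and> empty_f e) \<^bold>\<and>
      (\<^bold>\<forall>x. x \<^bold>\<in> a \<^bold>\<longrightarrow> (\<^bold>\<exists>y. y \<^bold>\<in> a \<^bold>\<and> (\<^bold>\<forall>w. w \<^bold>\<in> y \<^bold>\<longleftrightarrow> (w \<^bold>\<in> x \<^bold>\<or> w \<^bold>= x)))))"
    by (rule forces_axiom, rule IZF.infinity)
  \<comment> \<open>The function \<open>\<lambda>_. 0\<close> only supplies default values: the last
    formula mentions the levels 1 and 2 and the bound level 3.\<close>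
  then have "covered G (\<lambda>H. \<exists>a. covered H (\<lambda>K. \<exists>e. K \<tturnstile> Mem e a \<and> K \<tturnstile> empty_at e) \<and>
      (\<forall>x K. H \<le> K \<longrightarrow> K \<tturnstile> Mem x a \<longrightarrow> covered K (\<lambda>L. \<exists>y. L \<tturnstile> Mem y a \<and>
        L \<tturnstile> at ((\<lambda>_. 0)(0 := a, 1 := x, 2 := y)) 3 (\<^bold>\<forall>w. w \<^bold>\<in> 2 \<^bold>\<longleftrightarrow> (w \<^bold>\<in> 1 \<^bold>\<or> w \<^bold>= 1)))))"
    by (simp add: forces_simps forces_empty)
  then have "covered G (\<lambda>H. \<exists>a. covered H (\<lambda>K. \<exists>e. K \<tturnstile> Mem e a \<and> K \<tturnstile> empty_at e))"
    by (rule covered_mono) blast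
  then show ?thesis
    by (rule covered_bind) (blast intro: covered_mono)
qed

text \<open>Separate from \<open>a\<close> the empty \<open>x\<close> for which \<open>A\<close>
  holds: all members are empty, and \<open>e\<close> is a member exactly where \<open>A\<close> is
  forced. This carries results about set-coded propositions over to arbitrary formulas.\<close>

lemma prop_exists:
  "covered G (\<lambda>H. \<exists>q. H \<tturnstile> prop_at q \<and> (\<forall>K\<ge>H. K \<tturnstile> holds_at q \<longleftrightarrow> K \<tturnstile> A))"
  using empty_member_exists[of G]
proof (rule covered_bind)
  fix H assume "G \<le> H" and "\<exists>a e. H \<tturnstile> Mem e a \<and> H \<tturnstile> empty_at e"
  then obtain a e where e: "H \<tturnstile> Mem e a" "H \<tturnstile> empty_at e" by blast
  \<comment> \<open>Index 0 is the variable of separation, so the parameters of \<open>A\<close> are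
    shifted away from it.\<close>
  let ?B = "Conj (empty_at 0) (rename Suc A)"
  have B: "subst0 x ?B = Conj (empty_at x) A" for x
    by (simp add: subst0_def rename_rename empty_at_def inst_def at_def env_def
        form_defs)
  show "covered H (\<lambda>H. \<exists>q. H \<tturnstile> prop_at q \<and> (\<forall>K\<ge>H. K \<tturnstile> holds_at q \<longleftrightarrow> K \<tturnstile> A))"
    using separation_exists[of H a ?B]
  proof (rule covered_mono, elim exE)
    fix K q assume "H \<le> K"
      and "\<forall>x. \<forall>L\<ge>K. L \<tturnstile> Mem x q \<longleftrightarrow> L \<tturnstile> Mem x a \<and> L \<tturnstile> subst0 x ?B"
    then have q: "L \<tturnstile> Mem x q \<longleftrightarrow> L \<tturnstile> Mem x a \<and> L \<tturnstile> empty_at x \<and> L \<tturnstile> A"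
      if "K \<le> L" for L x
      using that by (simp add: B forces_Conj)
    have "K \<tturnstile> prop_at q"
      by (simp add: forces_prop_at q)
    moreover have "L \<tturnstile> holds_at q \<longleftrightarrow> L \<tturnstile> A" if L: "K \<le> L" for L
    proof
      assume "L \<tturnstile> holds_at q"
      then show "L \<tturnstile> A"
        unfolding forces_holds_at by (rule covered_forces) (use L q order_trans in blast)
    next
      assume "L \<tturnstile> A"
      moreover have "L \<tturnstile> Mem e a" "L \<tturnstile> empty_at e"
        using e \<open>H \<le> K\<close> L by (meson forces_mono order_trans)+
      ultimately show "L \<tturnstile> holds_at q"
        unfolding forces_holds_at by (intro coveredI) (use L q in blast)
    qed
    ultimately show "\<exists>q. K \<tturnstile> prop_at q \<and> (\<forall>L\<ge>K. L \<tturnstile> holds_at q \<longleftrightarrow> L \<tturnstile> A)"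
      by blast
  qed
qed

text \<open>The set lies inside the pair of \<open>x\<close> and \<open>y\<close>, so pairing
  followed by separation produces it.\<close>

lemma cond_exists: "covered G (\<lambda>H. \<exists>S. H \<tturnstile> cond_at S x y p)"
  using pairing_exists[of G x y]
proof (rule covered_bind, elim exE)
  fix H c
  assume c: "\<forall>w. \<forall>K\<ge>H. K \<tturnstile> Mem w c \<longleftrightarrow> covered K (\<lambda>L. L \<tturnstile> Eql w x \<or> L \<tturnstile> Eql w y)"
  let ?C = "\<lambda>w. Disj (Eql w x) (Conj (Eql w y) (holds_at p))"
  let ?A = "Disj (Eql 0 (Suc x)) (Conj (Eql 0 (Suc y)) (rename Suc (holds_at p)))"
  have A: "subst0 w ?A = ?C w" for w
    by (simp add: subst0_def rename_rename)
  \<comment> \<open>Every \<open>w\<close> with \<open>?C w\<close> already lies in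
    \<open>c\<close>, so separating from \<open>c\<close> loses nothing.\<close>
  have C: "L \<tturnstile> Mem w c" if "H \<le> L" "L \<tturnstile> ?C w" for L w
  proof -
    have "covered L (\<lambda>M. M \<tturnstile> Eql w x \<or> M \<tturnstile> Eql w y)"
      using that(2) unfolding forces_Disj forces_Conj
      by (rule covered_mono) blast
    then show ?thesis using c that(1) by blast
  qed
  show "covered H (\<lambda>H. \<exists>S. H \<tturnstile> cond_at S x y p)"
    using separation_exists[of H c ?A]
  proof (rule covered_mono, elim exE)
    fix K S assume "H \<le> K"
      and "\<forall>w. \<forall>L\<ge>K. L \<tturnstile> Mem w S \<longleftrightarrow> L \<tturnstile> Mem w c \<and> L \<tturnstile> subst0 w ?A"
    then have "L \<tturnstile> Mem w S \<longleftrightarrow> L \<tturnstile> ?C w" if "K \<le> L" for L w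
      using that C unfolding A by (meson order_trans)
    then have "K \<tturnstile> cond_at S x y p"
      by (simp add: forces_cond_at forces_Disj forces_Conj)
    then show "\<exists>S. K \<tturnstile> cond_at S x y p" ..
  qed
qed

section \<open>The supremum of a conditional set\<close>

lemma cond_cases:
  assumes "G \<tturnstile> cond_at S x y p" and "G \<tturnstile> Mem w S"
    and "\<And>H. G \<le> H \<Longrightarrow> H \<tturnstile> Eql w x \<Longrightarrow> H \<tturnstile> A"
    and "\<And>H. G \<le> H \<Longrightarrow> H \<tturnstile> Eql w y \<Longrightarrow> H \<tturnstile> holds_at p \<Longrightarrow> H \<tturnstile> A"
  shows "G \<tturnstile> A"
proof -
  have "covered G (\<lambda>K. K \<tturnstile> Eql w x \<or> K \<tturnstile> Eql w y \<and> K \<tturnstile> holds_at p)"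
    using assms(1,2) unfolding forces_cond_at by blast
  then show ?thesis
    by (rule covered_forces) (use assms(3,4) in blast)
qed

lemma cond_left: "G \<tturnstile> cond_at S x y p \<Longrightarrow> G \<tturnstile> Mem x S"
  unfolding forces_cond_at using forces_Eql_refl[of G x] by (blast intro: coveredI)

lemma cond_right: "G \<tturnstile> cond_at S x y p \<Longrightarrow> G \<tturnstile> holds_at p \<Longrightarrow> G \<tturnstile> Mem y S"
  unfolding forces_cond_at using forces_Eql_refl[of G y] by (blast intro: coveredI)

lemma Mem_Eql: "G \<tturnstile> Eql x x' \<Longrightarrow> G \<tturnstile> Mem x D \<Longrightarrow> G \<tturnstile> Mem x' D"
  using forces_Eql[of G x x' "\<lambda>k. D" "Mem 0 1"] by simp

text \<open>Two comparable elements of a dcpo at the stage \<open>G\<close>. Case analysis moves to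
  later stages, where \<open>dcpo_pair_mono\<close> makes the lemmas of the locale available
  again.\<close>

locale dcpo_pair =
  fixes G D le x y
  assumes dcpo: "G \<tturnstile> dcpo_at D le"
    and x: "G \<tturnstile> Mem x D" and y: "G \<tturnstile> Mem y D" and xy: "G \<tturnstile> rel_at le x y"
begin

lemma dcpo_pair_mono: "G \<le> H \<Longrightarrow> dcpo_pair H D le x y"
  using dcpo x y xy by unfold_locales (erule forces_mono, assumption)+

lemma cond_upper: "G \<tturnstile> cond_at S x y p \<Longrightarrow> G \<tturnstile> Mem w S \<Longrightarrow> G \<tturnstile> rel_at le w y"
proof (erule (1) cond_cases)
  fix H assume "G \<le> H" and "H \<tturnstile> Eql w x"
  then show "H \<tturnstile> rel_at le w y"
    using xy by (meson forces_Eql_refl forces_Eql_sym forces_mono forces_rel_at_Eql)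
next
  fix H assume "G \<le> H" and "H \<tturnstile> Eql w y"
  then show "H \<tturnstile> rel_at le w y"
    using dcpo_refl[OF dcpo y]
    by (meson forces_Eql_refl forces_Eql_sym forces_mono forces_rel_at_Eql)
qed

text \<open>Under \<open>p\<close> the element \<open>y\<close> belongs to the set, and it is an
  upper bound in any case.\<close>

lemma cond_sup_true:
  assumes "G \<tturnstile> cond_at S x y p" and s: "G \<tturnstile> sup_at D le S s" and "G \<tturnstile> holds_at p"
  shows "G \<tturnstile> Eql s y"
proof (rule dcpo_antisym[OF dcpo])
  show "G \<tturnstile> Mem s D" using s unfolding forces_sup_at by blast
  show "G \<tturnstile> Mem y D" by (rule y)
  \<comment> \<open>The leastness clause asks for the bound at all later stages, hence
    \<open>cond_upper\<close> at \<open>L\<close>.\<close>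
  have "L \<tturnstile> rel_at le a y" if "G \<le> L" "L \<tturnstile> Mem a S" for L a
    using dcpo_pair.cond_upper[OF dcpo_pair_mono] that assms(1) forces_mono by blast
  with s y show "G \<tturnstile> rel_at le s y" unfolding forces_sup_at by blast
  from s cond_right[OF assms(1,3)] show "G \<tturnstile> rel_at le y s" unfolding forces_sup_at by blast
qed

text \<open>With \<open>p\<close> refuted, only the case of equality with \<open>x\<close> survives,
  so \<open>x\<close> bounds the set of which it is a member.\<close>

lemma cond_sup_false:
  assumes cond: "G \<tturnstile> cond_at S x y p" and s: "G \<tturnstile> sup_at D le S s"
    and np: "G \<tturnstile> neg (holds_at p)"
  shows "G \<tturnstile> Eql s x"
proof (rule dcpo_antisym[OF dcpo])
  show "G \<tturnstile> Mem s D" using s unfolding forces_sup_at by blast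
  show "G \<tturnstile> Mem x D" by (rule x)
  have "L \<tturnstile> rel_at le a x" if L: "G \<le> L" and a: "L \<tturnstile> Mem a S" for L a
    using forces_mono[OF cond L] a
  proof (rule cond_cases)
    fix H assume "L \<le> H" and "H \<tturnstile> Eql a x"
    then show "H \<tturnstile> rel_at le a x"
      using dcpo_refl[OF dcpo x] L
      by (meson forces_Eql_refl forces_Eql_sym forces_mono forces_rel_at_Eql)
  next
    fix H assume "L \<le> H" and "H \<tturnstile> holds_at p"
    then show "H \<tturnstile> rel_at le a x"
      using np L unfolding forces_Imp by (meson forces_Bot order_trans)
  qed
  with s x show "G \<tturnstile> rel_at le s x" unfolding forces_sup_at by blast
  from s cond_left[OF cond] show "G \<tturnstile> rel_at le x s" unfolding forces_sup_at by blast
qed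

text \<open>Directedness is shown without deciding \<open>p\<close>: a member equals
  \<open>x\<close> or comes with a proof of \<open>p\<close>. If one of two members gives
  \<open>p\<close>, then \<open>y\<close> is a common bound in the set; otherwise both equal
  \<open>x\<close>, and \<open>x\<close> is one.\<close>

lemma cond_sup_exists:
  assumes cond: "G \<tturnstile> cond_at S x y p"
  shows "covered G (\<lambda>H. \<exists>s. H \<tturnstile> sup_at D le S s)"
proof (rule dcpo_sup[OF dcpo _ cond_left[OF cond]])
  fix H w assume H: "G \<le> H" and w: "H \<tturnstile> Mem w S"
  show "H \<tturnstile> Mem w D"
    using forces_mono[OF cond H] w
    by (rule cond_cases) (meson H Mem_Eql forces_Eql_sym forces_mono order_trans x y)+
next
  fix H a b assume H: "G \<le> H" and a: "H \<tturnstile> Mem a S" and b: "H \<tturnstile> Mem b S"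
  interpret H: dcpo_pair H D le x y by (rule dcpo_pair_mono[OF H])
  note condH = forces_mono[OF cond H]
  let ?Q = "\<lambda>K. \<exists>c. K \<tturnstile> Mem c S \<and> K \<tturnstile> rel_at le a c \<and> K \<tturnstile> rel_at le b c"
  have top: "?Q K" if "H \<le> K" "K \<tturnstile> holds_at p" for K
    using that a b condH H.cond_upper cond_right forces_mono by blast
  have cover: "covered H (\<lambda>K. K \<tturnstile> Eql w x \<or> K \<tturnstile> holds_at p)" if "H \<tturnstile> Mem w S" for w
  proof -
    have "covered H (\<lambda>K. K \<tturnstile> Eql w x \<or> K \<tturnstile> Eql w y \<and> K \<tturnstile> holds_at p)"
      using condH that unfolding forces_cond_at by blast
    then show ?thesis by (rule covered_mono) blast
  qed
  show "covered H ?Q"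
    using cover[OF a]
  proof (rule covered_bind)
    fix K assume K: "H \<le> K" and "K \<tturnstile> Eql a x \<or> K \<tturnstile> holds_at p"
    then consider "K \<tturnstile> Eql a x" | "K \<tturnstile> holds_at p" by blast
    then show "covered K ?Q"
    proof cases
      case 1
      have "K \<tturnstile> rel_at le x x"
        using dcpo_refl[OF H.dcpo H.x] K by (rule forces_mono)
      with 1 have ax: "K \<tturnstile> rel_at le a x"
        by (meson forces_Eql_refl forces_Eql_sym forces_rel_at_Eql)
      \<comment> \<open>Written as a disjunction, the cover persists from \<open>H\<close> to
        \<open>K\<close>.\<close>
      have "K \<tturnstile> Disj (Eql b x) (holds_at p)"
        using cover[OF b] K unfolding forces_Disj[symmetric] by (rule forces_mono)
      then show ?thesis unfolding forces_Disj
      proof (rule covered_bind)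
        fix L assume L: "K \<le> L" and "L \<tturnstile> Eql b x \<or> L \<tturnstile> holds_at p"
        then consider "L \<tturnstile> Eql b x" | "L \<tturnstile> holds_at p" by blast
        then show "covered L ?Q"
        proof cases
          case 1
          have "L \<tturnstile> rel_at le b x"
            using 1 forces_mono[OF \<open>K \<tturnstile> rel_at le x x\<close> L]
            by (meson forces_Eql_refl forces_Eql_sym forces_rel_at_Eql)
          moreover have "L \<tturnstile> Mem x S"
            using cond_left[OF condH] K L by (meson forces_mono)
          ultimately show ?thesis
            using forces_mono[OF ax L] by (blast intro: coveredI)
        next
          case 2
          with top[of L] K L show ?thesis by (blast intro: coveredI order_trans)
        qed
      qed
    next
      case 2
      with top K show ?thesis by (blast intro: coveredI)
    qed
  qed
qed

lemma cond_with_sup_exists: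
  "covered G (\<lambda>H. \<exists>S s. H \<tturnstile> cond_at S x y p \<and> H \<tturnstile> sup_at D le S s)"
  using cond_exists[of G x y p]
proof (rule covered_bind, elim exE)
  fix H S assume H: "G \<le> H" and S: "H \<tturnstile> cond_at S x y p"
  from dcpo_pair.cond_sup_exists[OF dcpo_pair_mono[OF H] S]
  show "covered H (\<lambda>H. \<exists>S s. H \<tturnstile> cond_at S x y p \<and> H \<tturnstile> sup_at D le S s)"
    by (rule covered_mono) (use S forces_mono in blast)
qed

section \<open>Tightness and excluded middle\<close>

lemma tight_stable:
  assumes below: "G \<tturnstile> strictly_below_at D le x y"
    and ap: "G \<tturnstile> apartness_at D ap" and tight: "G \<tturnstile> tight_at D ap"
    and p: "G \<tturnstile> prop_at p" and nnp: "G \<tturnstile> neg (neg (holds_at p))"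
  shows "G \<tturnstile> holds_at p"
  using cond_with_sup_exists[of p]
proof (rule covered_forces, elim exE conjE)
  fix H S s assume H: "G \<le> H" and S: "H \<tturnstile> cond_at S x y p" and s: "H \<tturnstile> sup_at D le S s"
  interpret H: dcpo_pair H D le x y by (rule dcpo_pair_mono[OF H])
  have sD: "H \<tturnstile> Mem s D" using s unfolding forces_sup_at by blast
  \<comment> \<open>Apartness of \<open>s\<close> from \<open>y\<close> refutes \<open>p\<close>,
    because \<open>p\<close> would make \<open>s\<close> equal to \<open>y\<close>; this conflicts
    with \<open>nnp\<close>.\<close>
  have "K \<tturnstile> Bot" if K: "H \<le> K" and sy: "K \<tturnstile> rel_at ap s y" for K
  proof -
    have "L \<tturnstile> Bot" if L: "K \<le> L" and "L \<tturnstile> holds_at p" for L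
    proof -
      have HL: "H \<le> L" using K L by (rule order_trans)
      have "L \<tturnstile> Eql s y"
        using dcpo_pair.cond_sup_true[OF H.dcpo_pair_mono[OF HL]] S s HL that(2) forces_mono
        by blast
      then have "L \<tturnstile> rel_at ap y y"
        using forces_mono[OF sy L] by (meson forces_Eql_refl forces_rel_at_Eql)
      then show ?thesis
        using ap y H HL by (meson apartness_irrefl forces_mono order_trans)
    qed
    then have "K \<tturnstile> neg (holds_at p)" unfolding forces_Imp by blast
    with nnp H K show ?thesis unfolding forces_Imp[of G] by (meson order_trans)
  qed
  then have "H \<tturnstile> neg (rel_at ap s y)" unfolding forces_Imp by blast
  \<comment> \<open>By tightness \<open>s\<close> equals \<open>y\<close>, so \<open>y\<close> is
    the supremum of the conditional set, as strictness requires.\<close>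
  then have "H \<tturnstile> Eql s y"
    using forces_mono[OF tight H] sD H.y by (blast intro: tight_Eql)
  then have "H \<tturnstile> sup_at D le S y" using s by (rule sup_at_Eql)
  then show "H \<tturnstile> holds_at p"
    using strictly_below_holds forces_mono[OF below H] H.y dcpo_refl[OF H.dcpo H.y]
      forces_mono[OF p H] S by blast
qed

lemma tight_excluded_middle:
  assumes below: "G \<tturnstile> strictly_below_at D le x y"
    and ap: "G \<tturnstile> apartness_at D ap" and tight: "G \<tturnstile> tight_at D ap"
  shows "G \<tturnstile> Disj A (neg A)"
  using prop_exists[of G "Disj A (neg A)"]
proof (rule covered_forces, elim exE conjE)
  fix H q assume H: "G \<le> H" and q: "H \<tturnstile> prop_at q"
    and holds: "\<forall>K\<ge>H. K \<tturnstile> holds_at q \<longleftrightarrow> K \<tturnstile> Disj A (neg A)"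
  interpret H: dcpo_pair H D le x y by (rule dcpo_pair_mono[OF H])
  have "K \<tturnstile> Bot" if K: "H \<le> K" and nq: "K \<tturnstile> neg (holds_at q)" for K
  proof -
    have "L \<tturnstile> Bot" if L: "K \<le> L" and "L \<tturnstile> Disj A (neg A)" for L
      using that nq holds K unfolding forces_Imp[of K] by (meson order_trans)
    \<comment> \<open>Refuting the disjunction refutes both disjuncts. The refutation of
      \<open>A\<close> is \<open>neg A\<close>, against the refutation of the second.\<close>
    then have no: "L \<tturnstile> Bot" if "K \<le> L" "L \<tturnstile> A \<or> L \<tturnstile> neg A" for L
      using that unfolding forces_Disj by (blast intro: coveredI)
    then have "K \<tturnstile> neg A" unfolding forces_Imp[of K A] by blast
    with no show ?thesis by blast
  qed
  then have "H \<tturnstile> neg (neg (holds_at q))" unfolding forces_Imp[of H] by blast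
  then have "H \<tturnstile> holds_at q"
    using H.tight_stable q forces_mono[OF below H] forces_mono[OF ap H] forces_mono[OF tight H]
    by blast
  with holds show "H \<tturnstile> Disj A (neg A)" by blast
qed

section \<open>Cotransitivity and weak excluded middle\<close>

lemma cotransitive_weak_excluded_middle:
  assumes apart: "G \<tturnstile> rel_at ap x y"
    and ap: "G \<tturnstile> apartness_at D ap" and cotrans: "G \<tturnstile> cotransitive_at D ap"
  shows "G \<tturnstile> Disj (neg (holds_at p)) (neg (neg (holds_at p)))"
  using cond_with_sup_exists[of p]
proof (rule covered_forces, elim exE conjE)
  fix H S s assume H: "G \<le> H" and S: "H \<tturnstile> cond_at S x y p" and s: "H \<tturnstile> sup_at D le S s"
  interpret H: dcpo_pair H D le x y by (rule dcpo_pair_mono[OF H])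
  have sD: "H \<tturnstile> Mem s D" using s unfolding forces_sup_at by blast
  \<comment> \<open>Replacing \<open>s\<close> by the equal \<open>z\<close> makes \<open>z\<close>
    apart from itself.\<close>
  have irrefl: "L \<tturnstile> Bot"
    if "H \<le> L" "L \<tturnstile> Mem z D" "L \<tturnstile> Eql s z" "L \<tturnstile> rel_at ap z s" for L z
    using that ap H by (meson apartness_irrefl forces_Eql_refl forces_mono forces_rel_at_Eql order_trans)
  have "covered H (\<lambda>K. K \<tturnstile> rel_at ap x s \<or> K \<tturnstile> rel_at ap y s)"
    using cotransitive_cases forces_mono[OF cotrans H] H.x H.y sD forces_mono[OF apart H]
    by blast
  then show "H \<tturnstile> Disj (neg (holds_at p)) (neg (neg (holds_at p)))"
  proof (unfold forces_Disj, rule covered_mono)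
    fix K assume K: "H \<le> K" and "K \<tturnstile> rel_at ap x s \<or> K \<tturnstile> rel_at ap y s"
    then consider "K \<tturnstile> rel_at ap x s" | "K \<tturnstile> rel_at ap y s" by blast
    then show "K \<tturnstile> neg (holds_at p) \<or> K \<tturnstile> neg (neg (holds_at p))"
    proof cases
      case 1
      \<comment> \<open>If \<open>p\<close> failed, \<open>s\<close> would equal \<open>x\<close>,
        from which it is apart.\<close>
      have "L \<tturnstile> Bot" if L: "K \<le> L" and np: "L \<tturnstile> neg (holds_at p)" for L
      proof -
        have HL: "H \<le> L" using K L by (rule order_trans)
        have "L \<tturnstile> Eql s x"
          using dcpo_pair.cond_sup_false[OF H.dcpo_pair_mono[OF HL]] S s HL np forces_mono
          by blast
        then show ?thesis
          using irrefl[OF HL] forces_mono[OF H.x HL] forces_mono[OF 1 L] by blast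
      qed
      then show ?thesis unfolding forces_Imp[of K "neg _"] by blast
    next
      case 2
      \<comment> \<open>If \<open>p\<close> held, \<open>s\<close> would equal \<open>y\<close>,
        from which it is apart.\<close>
      have "L \<tturnstile> Bot" if L: "K \<le> L" and p: "L \<tturnstile> holds_at p" for L
      proof -
        have HL: "H \<le> L" using K L by (rule order_trans)
        have "L \<tturnstile> Eql s y"
          using dcpo_pair.cond_sup_true[OF H.dcpo_pair_mono[OF HL]] S s HL p forces_mono
          by blast
        then show ?thesis
          using irrefl[OF HL] forces_mono[OF H.y HL] forces_mono[OF 2 L] by blast
      qed
      then show ?thesis unfolding forces_Imp[of K "holds_at p"] by blast
    qed
  qed
qed

end

theorem theorem5p6:
  shows "IZF_proves
      (\<^bold>\<forall>D. \<^bold>\<forall>le. \<^bold>\<forall>ap. dcpo D le \<^bold>\<longrightarrow> apartness D ap \<^bold>\<longrightarrow>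
        ((\<^bold>\<exists>x. x \<^bold>\<in> D \<^bold>\<and> (\<^bold>\<exists>y. y \<^bold>\<in> D \<^bold>\<and> strictly_below D le x y)) \<^bold>\<longrightarrow>
           tight D ap \<^bold>\<longrightarrow> excluded_middle) \<^bold>\<and>
        ((\<^bold>\<exists>x. x \<^bold>\<in> D \<^bold>\<and> (\<^bold>\<exists>y. y \<^bold>\<in> D \<^bold>\<and> rel le x y \<^bold>\<and> rel ap x y)) \<^bold>\<longrightarrow>
           cotransitive D ap \<^bold>\<longrightarrow> weak_excluded_middle))"
  (is "IZF_proves ?A")
proof -
  \<comment> \<open>The premises have the shape that unfolding leaves: nested implications give the
    chain of stages, and the existential hypothesis gives nested covers.\<close>
  have em: "L \<tturnstile> at \<rho> n excluded_middle"
    if "H \<tturnstile> dcpo_at D le" "H \<le> K" "K \<tturnstile> apartness_at D ap" "K \<le> K'"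
      "covered K' (\<lambda>M. \<exists>x. M \<tturnstile> Mem x D \<and>
        covered M (\<lambda>N. \<exists>y. N \<tturnstile> Mem y D \<and> N \<tturnstile> strictly_below_at D le x y))"
      "K' \<le> L" "L \<tturnstile> tight_at D ap"
    for H K K' L D le ap \<rho> n
  proof -
    \<comment> \<open>A cover is eliminated into a formula at the stage it covers, so the goal at
      \<open>L\<close> is recast as an implication at \<open>K'\<close>.\<close>
    have "K' \<tturnstile> Imp (tight_at D ap) (at \<rho> n excluded_middle)"
      using that(5)
    proof (rule covered_forces, elim exE conjE)
      fix M x assume M: "K' \<le> M" and x: "M \<tturnstile> Mem x D"
        and "covered M (\<lambda>N. \<exists>y. N \<tturnstile> Mem y D \<and> N \<tturnstile> strictly_below_at D le x y)"
      from this(3) show "M \<tturnstile> Imp (tight_at D ap) (at \<rho> n excluded_middle)"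
      proof (rule covered_forces, elim exE conjE)
        fix N y assume N: "M \<le> N" and y: "N \<tturnstile> Mem y D" and le: "N \<tturnstile> strictly_below_at D le x y"
        have "Q \<tturnstile> Disj (holds_at p) (neg (holds_at p))" if Q: "N \<le> Q" and t: "Q \<tturnstile> tight_at D ap" for Q p
        proof -
          have "Q \<tturnstile> dcpo_at D le" and ap: "Q \<tturnstile> apartness_at D ap" and "Q \<tturnstile> Mem x D"
            using Q \<open>H \<tturnstile> dcpo_at D le\<close> \<open>H \<le> K\<close> \<open>K \<tturnstile> apartness_at D ap\<close> \<open>K \<le> K'\<close> M N x
            by (meson forces_mono order_trans)+
          moreover have "Q \<tturnstile> rel_at le x y"
            using forces_mono[OF le Q] by (rule strictly_below_rel)
          ultimately interpret dcpo_pair Q D le x y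
            using forces_mono[OF y Q] by unfold_locales
          show ?thesis
            using forces_mono[OF le Q] ap t by (rule tight_excluded_middle)
        qed
        then show "N \<tturnstile> Imp (tight_at D ap) (at \<rho> n excluded_middle)"
          unfolding forces_Imp[of N] forces_excluded_middle by (meson forces_mono order_trans)
      qed
    qed
    with that(6,7) show ?thesis unfolding forces_Imp by blast
  qed
  have wem: "L \<tturnstile> at \<rho> n weak_excluded_middle"
    if "H \<tturnstile> dcpo_at D le" "H \<le> K" "K \<tturnstile> apartness_at D ap" "K \<le> K'"
      "covered K' (\<lambda>M. \<exists>x. M \<tturnstile> Mem x D \<and>
        covered M (\<lambda>N. \<exists>y. N \<tturnstile> Mem y D \<and> N \<tturnstile> rel_at le x y \<and> N \<tturnstile> rel_at ap x y))"
      "K' \<le> L" "L \<tturnstile> cotransitive_at D ap"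
    for H K K' L D le ap \<rho> n
  proof -
    have "K' \<tturnstile> Imp (cotransitive_at D ap) (at \<rho> n weak_excluded_middle)"
      using that(5)
    proof (rule covered_forces, elim exE conjE)
      fix M x assume M: "K' \<le> M" and x: "M \<tturnstile> Mem x D"
        and "covered M (\<lambda>N. \<exists>y. N \<tturnstile> Mem y D \<and> N \<tturnstile> rel_at le x y \<and> N \<tturnstile> rel_at ap x y)"
      from this(3) show "M \<tturnstile> Imp (cotransitive_at D ap) (at \<rho> n weak_excluded_middle)"
      proof (rule covered_forces, elim exE conjE)
        fix N y assume N: "M \<le> N" and y: "N \<tturnstile> Mem y D" 
          and le: "N \<tturnstile> rel_at le x y" and apart: "N \<tturnstile> rel_at ap x y"
        have "Q \<tturnstile> Disj (neg (holds_at p)) (neg (neg (holds_at p)))" if Q: "N \<le> Q" and t: "Q \<tturnstile> cotransitive_at D ap" for Q p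
        proof -
          have "Q \<tturnstile> dcpo_at D le" and ap: "Q \<tturnstile> apartness_at D ap" and "Q \<tturnstile> Mem x D"
            using Q \<open>H \<tturnstile> dcpo_at D le\<close> \<open>H \<le> K\<close> \<open>K \<tturnstile> apartness_at D ap\<close> \<open>K \<le> K'\<close> M N x
            by (meson forces_mono order_trans)+
          moreover have "Q \<tturnstile> rel_at le x y"
            using forces_mono[OF le Q] .
          ultimately interpret dcpo_pair Q D le x y
            using forces_mono[OF y Q] by unfold_locales
          show ?thesis
            using forces_mono[OF apart Q] ap t by (rule cotransitive_weak_excluded_middle)
        qed
        then show "N \<tturnstile> Imp (cotransitive_at D ap) (at \<rho> n weak_excluded_middle)"
          unfolding forces_Imp[of N] forces_weak_excluded_middle by (meson forces_mono order_trans)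
      qed
    qed
    with that(6,7) show ?thesis unfolding forces_Imp by blast
  qed
  have "{||} \<tturnstile> at \<rho> 0 ?A" for \<rho>
    by (simp add: forces_simps forces_dcpo forces_apartness forces_rel forces_strictly_below
        forces_tight forces_cotransitive) (blast intro: em wem)
  \<comment> \<open>Forcing at the empty context is provability, and at depth 0 the environment is
    the identity on indices.\<close>
  then show ?thesis
    by (simp add: IZF_proves_def forces_def at_def env_0)
qed

end
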